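(* Let $\beta\in(0,1]$, $R>0$, and let $\Phi:\mathbb{R}\to\mathbb{R}$ be weakly differentiable with derivative $\Phi'\in L^1_{loc}(\mathbb{R})$. Suppose that there is a constant $C>0$ such that $|\Phi'(u)|\le C\exp(C|u|)$ for all $u\in\mathbb{R}$. Let $f\in \mathcal{C}^\beta(R)$. Suppose that $\|\Phi'\circ f\|_2\neq 0$ and that the map $F':\mathcal{C}^\beta(R)\subseteq L^2([0,1])\to L^2([0,1])$, $F'(g)= \Phi'\circ g$, is continuous at $g=f$ with respect to the $L^2$-norms. Then the estimator $$\hat F_{\Phi,n}=\int_0^1\Phi(\hat{g}^{MLE}(x))\,dx-\frac{1}{n}\sum_{j\ge 1}\Phi'(Y_j)\mathbf{1}\big(\hat{g}^{MLE}(X_j)\ge Y_j\big)$$ of $F_\Phi(g)=\int_0^1\Phi(g(x))\,dx$ satisfies the local asymptotic upper bound $$\lim_{\delta\to 0}\limsup_{n\to\infty}\sup_{\substack{g\in\mathcal{C}^\beta(R):\\ \|f-g\|_2\le \delta}}n^{\frac{2\beta+1}{\beta+1}}\,\mathbb{E}_g\big[(\hat F_{\Phi,n}-F_\Phi(g))^2\big]\le \Gamma\Big(\frac{\beta}{\beta+1}\Big)\Big(\frac{2R\beta}{\beta+1}\Big)^{\frac{1}{\beta+1}}\|\Phi'\circ f\|_2^2,$$ where $\Gamma$ is the Gamma function.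
   Context: Model (PPP model): for each $n\in\mathbb{N}$ one observes the support points $(X_j,Y_j)_{j\ge1}$ of a Poisson point process on $[0,1]\times\mathbb{R}$ with intensity function $\lambda_g(x,y)=n\mathbf{1}(y\ge g(x))$, $x\in[0,1]$, $y\in\mathbb{R}$, where $g$ is an unknown support boundary curve. $\mathbb{E}_g$ denotes expectation under this law. Hölder ball: $\mathcal{C}^\beta(R)=\{g:[0,1]\to\mathbb{R}: |g(x)-g(y)|\le R|x-y|^\beta\ \forall x,y\in[0,1]\}$. The maximum-likelihood estimator over $\mathcal{C}^\beta(R)$ is $\hat g^{MLE}(x)=\min_{k\ge 1}\big(Y_k+R|x-X_k|^{\beta}\big)$, $x\in[0,1]$. Weak differentiability of $\Phi$ with derivative $\Phi'\in L^1_{loc}(\mathbb{R})$ means $\Phi(u)=\Phi(0)+\int_0^u\Phi'(v)\,dv$ for all $u\in\mathbb{R}$. $\|\cdot\|_2$ is the norm of $L^2([0,1])$. *)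

theory Defs
  imports "HOL-Probability.Probability"
begin

(* Curves on [0,1] are total functions on the reals; only their values on [0,1] matter. *)
definition hoelder_ball :: "real \<Rightarrow> real \<Rightarrow> (real \<Rightarrow> real) set" where
  "hoelder_ball \<beta> R =
     {g. \<forall>x\<in>{0..1}. \<forall>y\<in>{0..1}. \<bar>g x - g y\<bar> \<le> R * \<bar>x - y\<bar> powr \<beta>}"

(* The Bochner integral of a non-integrable function is 0, so this is the L2 norm
   only for h square-integrable on [0,1], e.g. Borel and bounded there. *)
definition norm_L2 :: "(real \<Rightarrow> real) \<Rightarrow> real" where
  "norm_L2 h = sqrt (LBINT x:{0..1}. (h x)\<^sup>2)"

definition L2_continuous_on_at ::
  "(real \<Rightarrow> real) set \<Rightarrow> ((real \<Rightarrow> real) \<Rightarrow> real \<Rightarrow> real) \<Rightarrow> (real \<Rightarrow> real) \<Rightarrow> bool" where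
  "L2_continuous_on_at G T f \<longleftrightarrow>
     (\<forall>\<epsilon>>0. \<exists>\<delta>>0. \<forall>g\<in>G. norm_L2 (\<lambda>x. g x - f x) < \<delta> \<longrightarrow>
        norm_L2 (\<lambda>x. T g x - T f x) < \<epsilon>)"

(* Integrability over all bounded intervals includes Borel measurability of \<Phi>'. The interval
   integral is the oriented one, so u < 0 is covered. *)
definition has_weak_derivative :: "(real \<Rightarrow> real) \<Rightarrow> (real \<Rightarrow> real) \<Rightarrow> bool" where
  "has_weak_derivative \<Phi> \<Phi>' \<longleftrightarrow>
     (\<forall>a b. set_integrable lborel {a..b} \<Phi>') \<and>
     (\<forall>u. \<Phi> u = \<Phi> 0 + (LBINT v=ereal 0..ereal u. \<Phi>' v))"

definition point_count :: "(nat \<Rightarrow> 'w \<Rightarrow> 'a) \<Rightarrow> 'a set \<Rightarrow> 'w \<Rightarrow> ennreal" where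
  "point_count Z A \<omega> = (\<Sum>j. indicator A (Z j \<omega>))"

(* A Poisson point process on space \<Lambda> with intensity measure \<Lambda>, given by an enumeration
   Z 0, Z 1, ... of its points. Such an enumeration by all of nat requires infinitely many points. *)
locale poisson_point_process = prob_space M
  for M :: "'w measure" and \<Lambda> :: "'a measure" and Z :: "nat \<Rightarrow> 'w \<Rightarrow> 'a" +
  assumes measurable_point: "Z j \<in> measurable M \<Lambda>"
    and poisson_count:
      "A \<in> sets \<Lambda> \<Longrightarrow> emeasure \<Lambda> A < \<infinity> \<Longrightarrow>
        prob {\<omega> \<in> space M. point_count Z A \<omega> = of_nat k} =
          exp (- measure \<Lambda> A) * measure \<Lambda> A ^ k / fact k"
    and infinite_count:
      "A \<in> sets \<Lambda> \<Longrightarrow> emeasure \<Lambda> A = \<infinity> \<Longrightarrow>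
        AE \<omega> in M. point_count Z A \<omega> = \<infinity>"
    and indep_counts:
      "disjoint_family B \<Longrightarrow> range B \<subseteq> sets \<Lambda> \<Longrightarrow>
        indep_vars (\<lambda>_. borel) (\<lambda>i::nat. point_count Z (B i)) UNIV"

definition boundary_intensity :: "nat \<Rightarrow> (real \<Rightarrow> real) \<Rightarrow> (real \<times> real) measure" where
  "boundary_intensity n g =
     density (restrict_space lborel ({0..1} \<times> UNIV))
       (\<lambda>(x, y). of_nat n * indicator {g x..} y)"

(* The estimators are functions of the observed points z k = (X_k, Y_k). In the model the minimum
   over k is almost surely attained, and then it is the infimum. *)
definition mle :: "real \<Rightarrow> real \<Rightarrow> (nat \<Rightarrow> real \<times> real) \<Rightarrow> real \<Rightarrow> real" where
  "mle \<beta> R z x = (INF k. snd (z k) + R * \<bar>x - fst (z k)\<bar> powr \<beta>)"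

definition functional :: "(real \<Rightarrow> real) \<Rightarrow> (real \<Rightarrow> real) \<Rightarrow> real" where
  "functional \<Phi> g = (LBINT x:{0..1}. \<Phi> (g x))"

(* In the model, almost surely only finitely many terms of the series are nonzero. *)
definition estimator ::
  "real \<Rightarrow> real \<Rightarrow> (real \<Rightarrow> real) \<Rightarrow> (real \<Rightarrow> real) \<Rightarrow> nat \<Rightarrow> (nat \<Rightarrow> real \<times> real) \<Rightarrow> real" where
  "estimator \<beta> R \<Phi> \<Phi>' n z =
     (LBINT x:{0..1}. \<Phi> (mle \<beta> R z x)) -
     1 / real n * (\<Sum>j. \<Phi>' (snd (z j)) * of_bool (mle \<beta> R z (fst (z j)) \<ge> snd (z j)))"

(* Nonnegative integral, so that an infinite risk is not silently read as 0. *)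
definition mean_squared_error ::
  "'w measure \<Rightarrow> (nat \<Rightarrow> 'w \<Rightarrow> 'a) \<Rightarrow> ((nat \<Rightarrow> 'a) \<Rightarrow> real) \<Rightarrow> real \<Rightarrow> ennreal" where
  "mean_squared_error M Z T \<theta> = (\<integral>\<^sup>+ \<omega>. ennreal ((T (\<lambda>j. Z j \<omega>) - \<theta>)\<^sup>2) \<partial>M)"

end

theory Submission
  imports Defs "HOL-Real_Asymp.Real_Asymp"
begin

text \<open>A point \<open>(x, y)\<close> lies on or below the graph of the estimated curve iff the observed process has
  no point in the open region \<open>below (x, y)\<close> under the cone with apex \<open>(x, y)\<close>. Up to the factor
  \<open>- 1 / n\<close> the estimation error is therefore the integral of \<open>\<Phi>' y\<close> times the indicator of this
  void event against the compensated process. The relation "\<open>w\<close> lies in \<open>below z\<close>" is asymmetric, so after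
  discretising into cells every mixed term contains an independent centred count and vanishes;
  Fatou's lemma then bounds the mean squared error by \<open>1 / n\<close> times the integral of \<open>\<Phi>'\<^sup>2\<close> against
  the void probability, which is at most \<open>exp (- n A)\<close>, where \<open>A\<close> is the area of one half of the region
  between two opposite cones. Since \<open>g + t\<close> is again in the Hoelder ball, continuity in \<open>L2\<close> at
  \<open>f\<close> controls the integral of \<open>\<Phi>' (g x + t)\<^sup>2\<close> over \<open>x\<close> for small \<open>t\<close>, the remaining \<open>t\<close>-integral is a Gamma
  integral, and large \<open>t\<close> contribute exponentially little.\<close>

section \<open>Compensated integrals of a Poisson point process\<close>

text \<open>The integrand depends on the process itself, so second-moment formulas for deterministic
  integrands do not apply. Membership of \<open>w\<close> in \<open>below z\<close> forces
  \<open>w\<close> to be lower than \<open>z\<close>, which makes the integrand predictable in the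
  direction of height; instead of a filtration, only independence of counts of disjoint sets is
  used. This is why void regions are approximated from inside by regions constant on cells:
  asymmetry survives at every level. A further obstacle is the infinite total intensity. Everything
  is done below a height T, and since the height that suffices depends on the realisation, T tends
  to infinity with a second use of Fatou's lemma. The constant comes from a cone of modulus R above
  a curve that may rise towards it at the same rate: at distance s from the apex the gap is at least
  t - 2R s^\<beta>. Near an endpoint of [0,1] only one side of the apex is available, hence the
  one-sided area q (2R)^(-1/\<beta>) t^(1 + 1/\<beta>) with q = \<beta>/(\<beta> + 1). The
  t-integral then scales as n^(-q), and the prefactor 1/n completes the rate.\<close>

context poisson_point_process
begin

text \<open>Counts are to be centred and squared, hence real-valued. The default value 0 of
  \<open>enn2real\<close> at infinity is harmless: the count of a set of finite intensity is almost
  surely finite.\<close>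

definition num :: "'a set \<Rightarrow> 'w \<Rightarrow> real" where
  "num A \<omega> = enn2real (point_count Z A \<omega>)"

text \<open>A real-valued indicator, ready to be multiplied with counts. \<open>vacant_eq\<close>
  rewrites it as a function of the count, the form to which independence of counts applies.\<close>

definition vacant :: "'a set \<Rightarrow> 'w \<Rightarrow> real" where
  "vacant A \<omega> = of_bool (\<forall>j. Z j \<omega> \<notin> A)"

lemma point_count_eq_0_iff: "point_count Z A \<omega> = 0 \<longleftrightarrow> (\<forall>j. Z j \<omega> \<notin> A)"
proof -
  have "point_count Z A \<omega> = 0 \<longleftrightarrow> (\<forall>j. (indicator A (Z j \<omega>) :: ennreal) = 0)"
    unfolding point_count_def by (intro suminf_eq_zero_iff) auto
  then show ?thesis by (auto simp: indicator_def)
qed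

lemma vacant_eq: "vacant A \<omega> = of_bool (point_count Z A \<omega> = 0)"
  by (simp add: vacant_def point_count_eq_0_iff)

lemma point_count_measurable [measurable]:
  assumes [measurable]: "A \<in> sets \<Lambda>"
  shows "point_count Z A \<in> borel_measurable M"
proof -
  have [measurable]: "Z j \<in> measurable M \<Lambda>" for j by (rule measurable_point)
  show ?thesis unfolding point_count_def by measurable
qed

lemma num_measurable [measurable]:
  "A \<in> sets \<Lambda> \<Longrightarrow> num A \<in> borel_measurable M"
  unfolding num_def by measurable

lemma vacant_measurable [measurable]:
  "A \<in> sets \<Lambda> \<Longrightarrow> vacant A \<in> borel_measurable M"
  unfolding vacant_eq[abs_def] by measurable

lemma vacant_bounds: "0 \<le> vacant A \<omega>" "vacant A \<omega> \<le> 1"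
  by (auto simp: vacant_def)

lemma integrable_vacant: "A \<in> sets \<Lambda> \<Longrightarrow> integrable M (vacant A)"
  by (rule integrable_const_bound[of _ 1]) (auto simp: vacant_def)

text \<open>The Poisson probabilities sum to 1, so the disjoint events with count k exhaust the
  space up to a null set.\<close>

lemma AE_point_count_nat:
  assumes A: "A \<in> sets \<Lambda>" "emeasure \<Lambda> A < \<infinity>"
  shows "AE \<omega> in M. \<exists>k::nat. point_count Z A \<omega> = of_nat k"
proof -
  define S where "S k = {\<omega> \<in> space M. point_count Z A \<omega> = of_nat k}" for k :: nat
  have [measurable]: "A \<in> sets \<Lambda>" by fact
  have S [measurable]: "S k \<in> sets M" for k unfolding S_def by measurable
  have disj: "disjoint_family S"
    by (auto simp: disjoint_family_on_def S_def)
  have "(\<lambda>k. measure M (S k)) sums measure M (\<Union>k. S k)"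
    by (rule finite_measure_UNION) (auto intro: disj)
  moreover have "(\<lambda>k. measure M (S k)) sums (exp (- measure \<Lambda> A) * exp (measure \<Lambda> A))"
  proof -
    have "measure M (S k) = exp (- measure \<Lambda> A) * (measure \<Lambda> A ^ k / fact k)" for k
      using poisson_count[OF A, of k] by (simp add: S_def)
    then show ?thesis
      using sums_mult[OF exp_converges[of "measure \<Lambda> A"], of "exp (- measure \<Lambda> A)"]
      by (simp add: divide_inverse mult_ac)
  qed
  ultimately have "measure M (\<Union>k. S k) = 1"
    using sums_unique2 by (fastforce simp: exp_minus)
  moreover have "(\<Union>k. S k) \<in> sets M" by auto
  ultimately have "AE \<omega> in M. \<omega> \<in> (\<Union>k. S k)"
    using prob_eq_1 by blast
  then show ?thesis by eventually_elim (auto simp: S_def)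
qed

section \<open>Moments and products of counts\<close>

lemma nn_integral_num:
  assumes A: "A \<in> sets \<Lambda>" "emeasure \<Lambda> A < \<infinity>" and F: "\<And>k. 0 \<le> F k"
    and s: "(\<lambda>k::nat. F (real k) * (exp (- measure \<Lambda> A) * measure \<Lambda> A ^ k / fact k)) sums s"
  shows "(\<integral>\<^sup>+\<omega>. ennreal (F (num A \<omega>)) \<partial>M) = ennreal s"
proof -
  define S where "S k = {\<omega> \<in> space M. point_count Z A \<omega> = of_nat k}" for k :: nat
  have [measurable]: "A \<in> sets \<Lambda>" by fact
  have S [measurable]: "S k \<in> sets M" for k unfolding S_def by measurable
  have "(\<integral>\<^sup>+\<omega>. ennreal (F (num A \<omega>)) \<partial>M) =
    (\<integral>\<^sup>+\<omega>. (\<Sum>k. ennreal (F (real k)) * indicator (S k) \<omega>) \<partial>M)"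
  proof (rule nn_integral_cong_AE)
    show "AE \<omega> in M. ennreal (F (num A \<omega>)) = (\<Sum>k. ennreal (F (real k)) * indicator (S k) \<omega>)"
      using AE_point_count_nat[OF A] AE_space
    proof eventually_elim
      case (elim \<omega>)
      then obtain m :: nat where m: "point_count Z A \<omega> = of_nat m" by blast
      have "(\<Sum>k. ennreal (F (real k)) * indicator (S k) \<omega>) =
        (\<Sum>k\<in>{m}. ennreal (F (real k)) * indicator (S k) \<omega>)"
        by (rule suminf_finite) (auto simp: S_def m indicator_def)
      then show ?case using elim by (simp add: S_def m num_def)
    qed
  qed
  also have "\<dots> = (\<Sum>k. ennreal (F (real k)) * emeasure M (S k))"
    by (subst nn_integral_suminf) (auto simp: nn_integral_cmult)
  also have "\<dots> = (\<Sum>k. ennreal (F (real k) * (exp (- measure \<Lambda> A) * measure \<Lambda> A ^ k / fact k)))"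
    using poisson_count[OF A]
    by (intro suminf_cong) (simp add: emeasure_eq_measure S_def F flip: ennreal_mult)
  also have "\<dots> = ennreal s"
    using s by (intro suminf_ennreal_eq) (auto simp: F)
  finally show ?thesis .
qed

lemma num_moments:
  assumes A: "A \<in> sets \<Lambda>" "emeasure \<Lambda> A < \<infinity>"
  shows "integrable M (num A)" "expectation (num A) = measure \<Lambda> A"
    and "integrable M (\<lambda>\<omega>. (num A \<omega> - measure \<Lambda> A)\<^sup>2)"
    and "expectation (\<lambda>\<omega>. (num A \<omega> - measure \<Lambda> A)\<^sup>2) = measure \<Lambda> A"
proof -
  have [measurable]: "A \<in> sets \<Lambda>" by fact
  define m where "m = measure \<Lambda> A"
  define p where "p k = exp (- m) * m ^ k / fact k" for k :: nat
  have p: "p sums 1"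
    using sums_mult[OF exp_converges[of m], of "exp (- m)"]
    by (simp add: p_def[abs_def] divide_inverse mult_ac exp_minus)
  \<comment> \<open>The Poisson recursion: after an index shift one factor k of a moment becomes a
    factor m, and the lost term at k = 0 is zero.\<close>
  have Suc: "real (Suc k) * p (Suc k) = m * p k" for k
    unfolding p_def fact_Suc power_Suc of_nat_mult by (simp add: divide_simps del: of_nat_Suc)
  have "(\<lambda>k. real (Suc k) * p (Suc k)) sums m"
    unfolding Suc using sums_mult[OF p, of m] by simp
  then have s1: "(\<lambda>k. real k * p k) sums m"
    by (subst (asm) sums_Suc_iff) simp
  have "(\<lambda>k. m * (real k * p k) + m * p k) sums (m * m + m * 1)"
    by (intro sums_add sums_mult s1 p)
  moreover have "(\<lambda>k. (real (Suc k))\<^sup>2 * p (Suc k)) = (\<lambda>k. m * (real k * p k) + m * p k)"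
  proof
    fix k
    have "(real (Suc k))\<^sup>2 * p (Suc k) = real (Suc k) * (real (Suc k) * p (Suc k))"
      by (simp add: power2_eq_square)
    then show "(real (Suc k))\<^sup>2 * p (Suc k) = m * (real k * p k) + m * p k"
      unfolding Suc by (simp add: algebra_simps)
  qed
  ultimately have "(\<lambda>k. (real (Suc k))\<^sup>2 * p (Suc k)) sums (m * m + m)"
    by simp
  then have s2: "(\<lambda>k. (real k)\<^sup>2 * p k) sums (m * m + m)"
    by (subst (asm) sums_Suc_iff) simp
  have m0: "0 \<le> m" by (simp add: m_def)
  \<comment> \<open>\<open>nn_integral_num\<close> asks for a function that is nonnegative on all
    reals, so \<open>max 0\<close> stands in for the identity.\<close>
  have n1: "(\<integral>\<^sup>+\<omega>. ennreal (num A \<omega>) \<partial>M) = ennreal m"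
    using nn_integral_num[OF A, of "\<lambda>k. max 0 k" m] s1
    by (simp add: p_def m_def num_def)
  have n2: "(\<integral>\<^sup>+\<omega>. ennreal ((num A \<omega>)\<^sup>2) \<partial>M) = ennreal (m * m + m)"
    using nn_integral_num[OF A, of "\<lambda>k. k\<^sup>2" "m * m + m"] s2
    by (simp add: p_def m_def)
  show i1: "integrable M (num A)"
    by (rule integrableI_nn_integral_finite[OF _ _ n1]) (auto simp: num_def)
  show e1: "expectation (num A) = measure \<Lambda> A"
    using n1 m0 by (intro integral_eq_nn_integral[THEN trans]) (auto simp: num_def m_def)
  have i2: "integrable M (\<lambda>\<omega>. (num A \<omega>)\<^sup>2)"
    by (rule integrableI_nn_integral_finite[OF _ _ n2]) auto
  have e2: "expectation (\<lambda>\<omega>. (num A \<omega>)\<^sup>2) = m * m + m"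
    using n2 m0 by (intro integral_eq_nn_integral[THEN trans]) (auto simp del: ennreal_plus)
  have eq: "(\<lambda>\<omega>. (num A \<omega> - measure \<Lambda> A)\<^sup>2) = (\<lambda>\<omega>. (num A \<omega>)\<^sup>2 - 2 * m * num A \<omega> + m\<^sup>2)"
    by (auto simp: power2_eq_square algebra_simps m_def)
  show "integrable M (\<lambda>\<omega>. (num A \<omega> - measure \<Lambda> A)\<^sup>2)"
    unfolding eq using i1 i2 by auto
  show "expectation (\<lambda>\<omega>. (num A \<omega> - measure \<Lambda> A)\<^sup>2) = measure \<Lambda> A"
    unfolding eq using i1 i2 e1 e2 by (simp add: prob_space power2_eq_square m_def)
qed

text \<open>Three disjoint sets suffice for all later uses, because a mixed term involves two cells
  and one joint void region.\<close>

lemma expectation_prod3: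
  fixes F G H :: "ennreal \<Rightarrow> real"
  assumes sets: "A \<in> sets \<Lambda>" "B \<in> sets \<Lambda>" "C \<in> sets \<Lambda>"
    and disj: "A \<inter> B = {}" "A \<inter> C = {}" "B \<inter> C = {}"
    and FGH [measurable]: "F \<in> borel_measurable borel" "G \<in> borel_measurable borel" "H \<in> borel_measurable borel"
    and int: "integrable M (\<lambda>\<omega>. F (point_count Z A \<omega>))" "integrable M (\<lambda>\<omega>. G (point_count Z B \<omega>))"
      "integrable M (\<lambda>\<omega>. H (point_count Z C \<omega>))"
  shows "integrable M (\<lambda>\<omega>. F (point_count Z A \<omega>) * G (point_count Z B \<omega>) * H (point_count Z C \<omega>))"
    and "expectation (\<lambda>\<omega>. F (point_count Z A \<omega>) * G (point_count Z B \<omega>) * H (point_count Z C \<omega>)) =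
      expectation (\<lambda>\<omega>. F (point_count Z A \<omega>)) * expectation (\<lambda>\<omega>. G (point_count Z B \<omega>)) *
      expectation (\<lambda>\<omega>. H (point_count Z C \<omega>))"
proof -
  \<comment> \<open>Independence is assumed for disjoint sequences, so the three sets are continued
    by empty ones.\<close>
  define S :: "nat \<Rightarrow> 'a set" where "S i = (if i = 0 then A else if i = 1 then B else if i = 2 then C else {})" for i
  define Y :: "nat \<Rightarrow> ennreal \<Rightarrow> real" where "Y i = (if i = 0 then F else if i = 1 then G else H)" for i
  have "indep_vars (\<lambda>_. borel) (\<lambda>i::nat. point_count Z (S i)) UNIV"
    by (rule indep_counts) (use sets disj in \<open>auto simp: S_def disjoint_family_on_def\<close>)
  then have "indep_vars (\<lambda>_. borel) (\<lambda>i \<omega>. Y i (point_count Z (S i) \<omega>)) UNIV"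
    by (rule indep_vars_compose2) (auto simp: Y_def)
  then have ind: "indep_vars (\<lambda>_. borel) (\<lambda>i \<omega>. Y i (point_count Z (S i) \<omega>)) {0,1,2}"
    by (rule indep_vars_subset) simp
  have int': "integrable M (\<lambda>\<omega>. Y i (point_count Z (S i) \<omega>))" if "i \<in> {0,1,2}" for i
    using that int by (auto simp: Y_def S_def)
  show "integrable M (\<lambda>\<omega>. F (point_count Z A \<omega>) * G (point_count Z B \<omega>) * H (point_count Z C \<omega>))"
    using indep_vars_integrable[OF _ ind int'] by (simp add: Y_def S_def mult_ac)
  show "expectation (\<lambda>\<omega>. F (point_count Z A \<omega>) * G (point_count Z B \<omega>) * H (point_count Z C \<omega>)) =
      expectation (\<lambda>\<omega>. F (point_count Z A \<omega>)) * expectation (\<lambda>\<omega>. G (point_count Z B \<omega>)) *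
      expectation (\<lambda>\<omega>. H (point_count Z C \<omega>))"
    using indep_vars_lebesgue_integral[OF _ ind int'] by (simp add: Y_def S_def mult_ac)
qed

text \<open>The cell and its void region are disjoint, so the centred square, whose mean is the
  Poisson variance, is independent of the void event. The spare third slot of
  \<open>expectation_prod3\<close> holds the empty set and the constant 1.\<close>

lemma compensated_isometry_diag:
  assumes c: "c \<in> sets \<Lambda>" "emeasure \<Lambda> c < \<infinity>" and D: "D \<in> sets \<Lambda>" "c \<inter> D = {}"
  defines "X \<equiv> \<lambda>\<omega>. vacant D \<omega> * (num c \<omega> - measure \<Lambda> c)"
  shows "integrable M (\<lambda>\<omega>. X \<omega> * X \<omega>)"
    and "expectation (\<lambda>\<omega>. X \<omega> * X \<omega>) = expectation (vacant D) * measure \<Lambda> c"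
proof -
  have eq: "(\<lambda>\<omega>. X \<omega> * X \<omega>) = (\<lambda>\<omega>. (enn2real (point_count Z c \<omega>) - measure \<Lambda> c)\<^sup>2 *
    of_bool (point_count Z D \<omega> = 0) * (\<lambda>_. 1) (point_count Z {} \<omega>))"
    by (auto simp: X_def vacant_eq num_def power2_eq_square)
  note * = expectation_prod3[of c D "{}" "\<lambda>x. (enn2real x - measure \<Lambda> c)\<^sup>2" "\<lambda>x. of_bool (x = 0)" "\<lambda>_. 1"]
  have i: "integrable M (\<lambda>\<omega>. of_bool (point_count Z D \<omega> = 0) :: real)"
    using integrable_vacant[OF D(1)] by (simp add: vacant_eq[abs_def])
  show "integrable M (\<lambda>\<omega>. X \<omega> * X \<omega>)"
    unfolding eq using c D num_moments(3)[OF c] i by (intro *(1)) (auto simp: num_def)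
  have "expectation (\<lambda>\<omega>. X \<omega> * X \<omega>) = expectation (\<lambda>\<omega>. (enn2real (point_count Z c \<omega>) - measure \<Lambda> c)\<^sup>2) *
     expectation (\<lambda>\<omega>. of_bool (point_count Z D \<omega> = 0)) * expectation (\<lambda>_. 1)"
    unfolding eq using c D num_moments(3)[OF c] i by (intro *(2)) (auto simp: num_def)
  then show "expectation (\<lambda>\<omega>. X \<omega> * X \<omega>) = expectation (vacant D) * measure \<Lambda> c"
    using num_moments(4)[OF c] by (simp add: num_def vacant_eq[abs_def] prob_space)
qed

section \<open>Orthogonality of centred counts on void events\<close>

lemma point_count_Un_disjoint:
  "A \<inter> B = {} \<Longrightarrow> point_count Z (A \<union> B) \<omega> = point_count Z A \<omega> + point_count Z B \<omega>"
  unfolding point_count_def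
  by (subst suminf_add) (auto simp: indicator_def disjoint_iff intro!: suminf_cong)

text \<open>On the event that \<open>D\<close> is vacant, \<open>c'\<close> may be replaced by \<open>c' - D\<close>, and the three sets
  \<open>c\<close>, \<open>c' - D\<close> and \<open>D\<close> are disjoint.\<close>

lemma compensated_orthogonal:
  assumes c: "c \<in> sets \<Lambda>" "emeasure \<Lambda> c < \<infinity>" and c': "c' \<in> sets \<Lambda>" "emeasure \<Lambda> c' < \<infinity>"
    and D: "D1 \<in> sets \<Lambda>" "D2 \<in> sets \<Lambda>" and disj: "c \<inter> D1 = {}" "c \<inter> D2 = {}" "c \<inter> c' = {}"
  defines "X \<equiv> \<lambda>\<omega>. (vacant D1 \<omega> * (num c \<omega> - measure \<Lambda> c)) * (vacant D2 \<omega> * (num c' \<omega> - measure \<Lambda> c'))"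
  shows "integrable M X" and "expectation X = 0"
proof -
  define D where "D = D1 \<union> D2"
  have vac: "vacant D1 \<omega> * vacant D2 \<omega> = vacant D \<omega>" for \<omega>
    by (auto simp: vacant_def D_def)
  have *: "num c' \<omega> = num (c' - D) \<omega>" if "vacant D \<omega> \<noteq> 0" for \<omega>
  proof -
    have "point_count Z (c' \<inter> D) \<omega> = 0"
      using that by (auto simp: point_count_eq_0_iff vacant_def split: if_splits)
    then show ?thesis
      using point_count_Un_disjoint[of "c' - D" "c' \<inter> D" \<omega>] by (simp add: num_def Un_Diff_Int Int_Diff Int_Diff_disjoint disjoint_iff)
  qed
  have eq: "X = (\<lambda>\<omega>. (enn2real (point_count Z c \<omega>) - measure \<Lambda> c) *
    (enn2real (point_count Z (c' - D) \<omega>) - measure \<Lambda> c') * of_bool (point_count Z D \<omega> = 0))"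
  proof
    fix \<omega>
    have "X \<omega> = (vacant D1 \<omega> * vacant D2 \<omega>) * ((num c \<omega> - measure \<Lambda> c) * (num c' \<omega> - measure \<Lambda> c'))"
      by (simp add: X_def)
    also have "\<dots> = (num c \<omega> - measure \<Lambda> c) * (num (c' - D) \<omega> - measure \<Lambda> c') * vacant D \<omega>"
      unfolding vac using *[of \<omega>] by (cases "vacant D \<omega> = 0") auto
    finally show "X \<omega> = (enn2real (point_count Z c \<omega>) - measure \<Lambda> c) *
      (enn2real (point_count Z (c' - D) \<omega>) - measure \<Lambda> c') * of_bool (point_count Z D \<omega> = 0)"
      by (simp add: vacant_eq num_def)
  qed
  have D': "D \<in> sets \<Lambda>" "c' - D \<in> sets \<Lambda>" using D c' by (auto simp: D_def)
  have fin: "emeasure \<Lambda> (c' - D) < \<infinity>"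
    using c' by (meson Diff_subset emeasure_mono le_less_trans)
  have i: "integrable M (\<lambda>\<omega>. of_bool (point_count Z D \<omega> = 0) :: real)"
    using integrable_vacant[OF D'(1)] by (simp add: vacant_eq[abs_def])
  have i1: "integrable M (\<lambda>\<omega>. enn2real (point_count Z c \<omega>) - measure \<Lambda> c)"
    using num_moments(1)[OF c] by (simp add: num_def[abs_def])
  have i2: "integrable M (\<lambda>\<omega>. enn2real (point_count Z (c' - D) \<omega>) - measure \<Lambda> c')"
    using num_moments(1)[OF D'(2) fin] by (simp add: num_def[abs_def])
  note * = expectation_prod3[of c "c' - D" D "\<lambda>x. enn2real x - measure \<Lambda> c"
    "\<lambda>x. enn2real x - measure \<Lambda> c'" "\<lambda>x. of_bool (x = 0)", OF c(1) D'(2,1) _ _ _ _ _ _ i1 i2 i]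
  show "integrable M X"
    unfolding eq using disj by (intro *(1)) (auto simp: D_def)
  \<comment> \<open>Only the factor on \<open>c\<close> is claimed to have mean zero:
    \<open>measure \<Lambda> c'\<close> need not be the mean of the count on \<open>c' - D\<close>.
    One vanishing factor is enough.\<close>
  have "expectation (\<lambda>\<omega>. enn2real (point_count Z c \<omega>) - measure \<Lambda> c) = 0"
    using num_moments(1,2)[OF c] by (simp add: num_def[abs_def] prob_space)
  then show "expectation X = 0"
    unfolding eq using disj by (subst *(2)) (auto simp: D_def)
qed

text \<open>Off-diagonal terms vanish one by one: for each pair, \<open>pred\<close> provides a cell
  that avoids the other's void region, and this cell plays the part of \<open>c\<close> in
  \<open>compensated_orthogonal\<close>. It may be either of the two, so one case commutes the
  product.\<close>

lemma compensated_isometry: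
  fixes a :: "'i \<Rightarrow> real" and c D :: "'i \<Rightarrow> 'a set"
  assumes I: "finite I" "disjoint_family_on c I"
    and c: "\<And>i. i \<in> I \<Longrightarrow> c i \<in> sets \<Lambda>" "\<And>i. i \<in> I \<Longrightarrow> emeasure \<Lambda> (c i) < \<infinity>"
    and D: "\<And>i. i \<in> I \<Longrightarrow> D i \<in> sets \<Lambda>" "\<And>i. i \<in> I \<Longrightarrow> c i \<inter> D i = {}"
    and pred: "\<And>i j. i \<in> I \<Longrightarrow> j \<in> I \<Longrightarrow> i \<noteq> j \<Longrightarrow> c i \<inter> D j = {} \<or> c j \<inter> D i = {}"
  shows "(\<integral>\<^sup>+\<omega>. ennreal ((\<Sum>i\<in>I. a i * vacant (D i) \<omega> * (num (c i) \<omega> - measure \<Lambda> (c i)))\<^sup>2) \<partial>M) =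
    ennreal (\<Sum>i\<in>I. (a i)\<^sup>2 * expectation (vacant (D i)) * measure \<Lambda> (c i))"
proof -
  define X where "X i \<omega> = vacant (D i) \<omega> * (num (c i) \<omega> - measure \<Lambda> (c i))" for i \<omega>
  have off: "integrable M (\<lambda>\<omega>. X i \<omega> * X j \<omega>) \<and> expectation (\<lambda>\<omega>. X i \<omega> * X j \<omega>) = 0"
    if ij: "i \<in> I" "j \<in> I" "i \<noteq> j" for i j
  proof -
    have d: "c i \<inter> c j = {}" using I(2) ij by (auto simp: disjoint_family_on_def)
    from pred[OF ij] show ?thesis
    proof
      assume "c i \<inter> D j = {}"
      then show ?thesis unfolding X_def
        by (intro conjI compensated_orthogonal) (use ij c D d in auto)
    next
      assume "c j \<inter> D i = {}"
      then have "integrable M (\<lambda>\<omega>. X j \<omega> * X i \<omega>) \<and> expectation (\<lambda>\<omega>. X j \<omega> * X i \<omega>) = 0"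
        unfolding X_def by (intro conjI compensated_orthogonal) (use ij c D d in auto)
      then show ?thesis by (simp add: mult.commute)
    qed
  qed
  have diag: "integrable M (\<lambda>\<omega>. X i \<omega> * X i \<omega>)"
    "expectation (\<lambda>\<omega>. X i \<omega> * X i \<omega>) = expectation (vacant (D i)) * measure \<Lambda> (c i)" if "i \<in> I" for i
    unfolding X_def using compensated_isometry_diag[OF c[OF that] D[OF that]] by auto
  have int: "integrable M (\<lambda>\<omega>. X i \<omega> * X j \<omega>)" if "i \<in> I" "j \<in> I" for i j
    using diag(1) off that by (cases "i = j") auto
  have eq: "(\<Sum>i\<in>I. a i * vacant (D i) \<omega> * (num (c i) \<omega> - measure \<Lambda> (c i)))\<^sup>2 =
    (\<Sum>i\<in>I. \<Sum>j\<in>I. a i * a j * (X i \<omega> * X j \<omega>))" for \<omega>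
    by (simp add: X_def power2_eq_square sum_product mult_ac)
  have "expectation (\<lambda>\<omega>. \<Sum>i\<in>I. \<Sum>j\<in>I. a i * a j * (X i \<omega> * X j \<omega>)) =
    (\<Sum>i\<in>I. \<Sum>j\<in>I. a i * a j * expectation (\<lambda>\<omega>. X i \<omega> * X j \<omega>))"
    using int by (simp add: Bochner_Integration.integral_sum)
  also have "\<dots> = (\<Sum>i\<in>I. \<Sum>j\<in>I. if i = j then (a i)\<^sup>2 * expectation (vacant (D i)) * measure \<Lambda> (c i) else 0)"
    using off diag(2) by (intro sum.cong refl) (auto simp: power2_eq_square)
  also have "\<dots> = (\<Sum>i\<in>I. (a i)\<^sup>2 * expectation (vacant (D i)) * measure \<Lambda> (c i))"
    using I by simp
  finally have "expectation (\<lambda>\<omega>. \<Sum>i\<in>I. \<Sum>j\<in>I. a i * a j * (X i \<omega> * X j \<omega>)) = \<dots>" .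
  moreover have "integrable M (\<lambda>\<omega>. \<Sum>i\<in>I. \<Sum>j\<in>I. a i * a j * (X i \<omega> * X j \<omega>))"
    using int by auto
  ultimately show ?thesis
    unfolding eq
    by (subst nn_integral_eq_integral) (auto simp: eq[symmetric])
qed

text \<open>Counts of all subsets of \<open>K\<close> become finite sums over one common index set,
  so that sums over cells and sums over points can be exchanged.\<close>

lemma num_finite_points:
  assumes "point_count Z K \<omega> < \<infinity>"
  shows "finite {j. Z j \<omega> \<in> K}"
    and "A \<subseteq> K \<Longrightarrow> num A \<omega> = (\<Sum>j | Z j \<omega> \<in> K. indicator A (Z j \<omega>))"
proof -
  have "(\<Sum>j. indicator K (Z j \<omega>) :: ennreal) = (\<integral>\<^sup>+j. indicator {j. Z j \<omega> \<in> K} j \<partial>count_space UNIV)"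
    by (subst nn_integral_count_space_nat) (auto intro!: suminf_cong simp: indicator_def)
  also have "\<dots> = emeasure (count_space UNIV) {j. Z j \<omega> \<in> K}"
    by (subst nn_integral_indicator) auto
  finally have "emeasure (count_space UNIV) {j. Z j \<omega> \<in> K} < \<infinity>"
    using assms by (simp add: point_count_def)
  then show fin: "finite {j. Z j \<omega> \<in> K}"
    by (simp add: emeasure_count_space split: if_splits)
  assume "A \<subseteq> K"
  then have "point_count Z A \<omega> = (\<Sum>j | Z j \<omega> \<in> K. indicator A (Z j \<omega>))"
    unfolding point_count_def by (intro suminf_finite fin) (auto simp: indicator_def)
  also have "\<dots> = ennreal (\<Sum>j | Z j \<omega> \<in> K. indicator A (Z j \<omega>))"
    by (subst sum_ennreal[symmetric]) (auto simp: ennreal_indicator)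
  finally show "num A \<omega> = (\<Sum>j | Z j \<omega> \<in> K. indicator A (Z j \<omega>))"
    by (simp add: num_def sum_nonneg)
qed

lemma AE_point_count_finite:
  "K \<in> sets \<Lambda> \<Longrightarrow> emeasure \<Lambda> K < \<infinity> \<Longrightarrow> AE \<omega> in M. point_count Z K \<omega> < \<infinity>"
  by (drule (1) AE_point_count_nat) (auto simp: of_nat_less_top elim!: eventually_mono)

text \<open>The predictable integrand \<open>z \<mapsto> \<phi> z \<cdot> vacant (D z)\<close> is the limit of integrands that are constant
  on the cells of the partitions \<open>key m\<close>; asymmetry of \<open>w \<in> D z\<close> makes the cells orthogonal.\<close>

lemma compensated_integral_second_moment_le:
  fixes key :: "nat \<Rightarrow> 'a \<Rightarrow> 'i" and a :: "nat \<Rightarrow> 'i \<Rightarrow> real" and \<phi> :: "'a \<Rightarrow> real"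
  assumes K: "K \<in> sets \<Lambda>" "emeasure \<Lambda> K < \<infinity>"
    and fin: "\<And>m. finite (key m ` K)"
    and cells: "\<And>m i. {z \<in> K. key m z = i} \<in> sets \<Lambda>"
    and Dm: "\<And>m i. Dm m i \<in> sets \<Lambda>"
    and asym: "\<And>w z. w \<in> K \<Longrightarrow> z \<in> K \<Longrightarrow> w \<in> D z \<Longrightarrow> z \<notin> D w"
    and inner: "\<And>m w z. z \<in> K \<Longrightarrow> w \<in> Dm m (key m z) \<Longrightarrow> w \<in> D z"
    and outer: "\<And>w z. z \<in> K \<Longrightarrow> w \<in> space \<Lambda> \<Longrightarrow> w \<in> D z \<Longrightarrow> \<forall>\<^sub>F m in sequentially. w \<in> Dm m (key m z)"
    and lim: "\<And>z. z \<in> K \<Longrightarrow> (\<lambda>m. a m (key m z)) \<longlonglongrightarrow> \<phi> z"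
    and bound: "\<And>m z. z \<in> K \<Longrightarrow> \<bar>a m (key m z)\<bar> \<le> B"
  obtains J where "J \<in> borel_measurable M"
    and "AE \<omega> in M. J \<omega> = (\<Sum>j | Z j \<omega> \<in> K. \<phi> (Z j \<omega>) * vacant (D (Z j \<omega>)) \<omega>) -
      (LINT z:K|\<Lambda>. \<phi> z * vacant (D z) \<omega>)"
    and "(\<integral>\<^sup>+\<omega>. ennreal ((J \<omega>)\<^sup>2) \<partial>M) \<le>
      (\<integral>\<^sup>+z. ennreal ((\<phi> z)\<^sup>2 * expectation (vacant (D z))) * indicator K z \<partial>\<Lambda>)"
proof -
  note [measurable] = K(1) Dm
  define c where "c m i = {z \<in> K. key m z = i}" for m i
  define I where "I m = key m ` K" for m
  have c: "c m i \<in> sets \<Lambda>" "c m i \<subseteq> K" for m i using cells by (auto simp: c_def)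
  have finI: "finite (I m)" for m using fin by (simp add: I_def)
  have c_fin: "emeasure \<Lambda> (c m i) < \<infinity>" for m i
    using emeasure_mono[OF c(2) K(1)] K(2) by (meson le_less_trans)
  \<comment> \<open>Only finitely many cells meet \<open>K\<close>, so functions of
    \<open>key m\<close> are simple functions there, measurable by \<open>cells\<close>
    alone.\<close>
  have step: "u (key m z) * indicator K z = (\<Sum>i\<in>I m. u i * indicator (c m i) z)" for m z and u :: "'i \<Rightarrow> real"
  proof (cases "z \<in> K")
    case True
    have "(\<Sum>i\<in>I m. u i * indicator (c m i) z) = (\<Sum>i\<in>I m. if i = key m z then u i else 0)"
      using True by (intro sum.cong) (auto simp: c_def indicator_def)
    then show ?thesis using True finI by (simp add: I_def)
  qed (auto simp: c_def)
  have step_meas [measurable]: "(\<lambda>z. u (key m z) * indicator K z) \<in> borel_measurable \<Lambda>" for m and u :: "'i \<Rightarrow> real"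
    unfolding step using c(1) by measurable
  have step_int: "(LINT z|\<Lambda>. u (key m z) * indicator K z) = (\<Sum>i\<in>I m. u i * measure \<Lambda> (c m i))"
    for m and u :: "'i \<Rightarrow> real"
  proof -
    have "integrable \<Lambda> (\<lambda>z. u i * indicator (c m i) z)" for i
      using c(1) c_fin by (intro integrable_mult_right) (auto simp: less_top)
    moreover have "c m i \<inter> space \<Lambda> = c m i" for i using sets.sets_into_space[OF c(1)] by blast
    ultimately show ?thesis
      unfolding step by (subst Bochner_Integration.integral_sum) auto
  qed
  \<comment> \<open>By \<open>inner\<close>, \<open>Dm\<close> lies inside the region of every point
    of its cell in \<open>K\<close>. Two cells meeting each other's regions would thus contain w and
    w' with w in \<open>D w'\<close> and w' in \<open>D w\<close>. The case i = j shows that a cell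
    avoids its own region.\<close>
  have asym': "c m i \<inter> Dm m j = {} \<or> c m j \<inter> Dm m i = {}" for m i j
  proof (rule ccontr)
    assume "\<not> ?thesis"
    then obtain w w' where "w \<in> c m i" "w \<in> Dm m j" "w' \<in> c m j" "w' \<in> Dm m i" by blast
    with inner[of w' w m] inner[of w w' m] asym[of w w'] show False by (auto simp: c_def)
  qed
  define X where "X m \<omega> = (\<Sum>i\<in>I m. a m i * vacant (Dm m i) \<omega> * (num (c m i) \<omega> - measure \<Lambda> (c m i)))" for m \<omega>
  have X_meas [measurable]: "X m \<in> borel_measurable M" for m
    unfolding X_def using c(1) by measurable
  define p where "p m z = expectation (vacant (Dm m (key m z)))" for m z
  have X_moment: "(\<integral>\<^sup>+\<omega>. ennreal ((X m \<omega>)\<^sup>2) \<partial>M) =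
    ennreal (LINT z|\<Lambda>. ((a m (key m z))\<^sup>2 * p m z) * indicator K z)" for m
  proof -
    have "(\<integral>\<^sup>+\<omega>. ennreal ((X m \<omega>)\<^sup>2) \<partial>M) =
      ennreal (\<Sum>i\<in>I m. (a m i)\<^sup>2 * expectation (vacant (Dm m i)) * measure \<Lambda> (c m i))"
      unfolding X_def using asym' asym'[of m i i for i] c c_fin
      by (intro compensated_isometry finI) (auto simp: disjoint_family_on_def c_def Dm)
    then show ?thesis
      using step_int[of "\<lambda>i. (a m i)\<^sup>2 * expectation (vacant (Dm m i))" m] by (simp add: p_def)
  qed
  \<comment> \<open>If no point lies in \<open>D z\<close>, none lies in the smaller
    \<open>Dm\<close>; otherwise a single point of \<open>D z\<close> is eventually caught by
    \<open>outer\<close>.\<close>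
  have vac_lim: "(\<lambda>m. vacant (Dm m (key m z)) \<omega>) \<longlonglongrightarrow> vacant (D z) \<omega>"
    if "z \<in> K" "\<omega> \<in> space M" for z \<omega>
  proof (cases "\<forall>j. Z j \<omega> \<notin> D z")
    case True
    then have "vacant (Dm m (key m z)) \<omega> = vacant (D z) \<omega>" for m
      using inner[OF that(1), of _ m] by (auto simp: vacant_def)
    then show ?thesis by simp
  next
    case False
    then obtain j where j: "Z j \<omega> \<in> D z" by blast
    have "Z j \<omega> \<in> space \<Lambda>" using measurable_space[OF measurable_point that(2)] .
    from outer[OF that(1) this j]
    have "\<forall>\<^sub>F m in sequentially. vacant (Dm m (key m z)) \<omega> = vacant (D z) \<omega>"
      by eventually_elim (use j in \<open>auto simp: vacant_def\<close>)
    then show ?thesis by (rule tendsto_eventually)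
  qed
  have p_lim: "(\<lambda>m. p m z) \<longlonglongrightarrow> expectation (vacant (D z))" if "z \<in> K" for z
    unfolding p_def
  proof (rule integral_dominated_convergence[where w="\<lambda>_. 1"])
    show "AE \<omega> in M. (\<lambda>m. vacant (Dm m (key m z)) \<omega>) \<longlonglongrightarrow> vacant (D z) \<omega>"
      using vac_lim[OF that] by auto
    \<comment> \<open>\<open>D z\<close> itself is not assumed measurable; its void indicator is, as
      a limit.\<close>
    show "vacant (D z) \<in> borel_measurable M"
      by (rule borel_measurable_LIMSEQ_real[OF vac_lim[OF that]]) measurable
  qed (auto simp: vacant_bounds)
  have p_bounds: "0 \<le> p m z" "p m z \<le> 1" for m z
  proof -
    show "0 \<le> p m z" unfolding p_def by (rule Bochner_Integration.integral_nonneg) (simp add: vacant_bounds)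
    have "p m z \<le> expectation (\<lambda>_. 1)"
      unfolding p_def by (rule integral_mono) (auto simp: integrable_vacant vacant_bounds)
    then show "p m z \<le> 1" by (simp add: prob_space)
  qed
  define q where "q z = ((\<phi> z)\<^sup>2 * expectation (vacant (D z))) * indicator K z" for z
  have q_lim: "(\<lambda>m. ((a m (key m z))\<^sup>2 * p m z) * indicator K z) \<longlonglongrightarrow> q z" for z
    unfolding q_def using lim[of z] p_lim[of z]
    by (cases "z \<in> K") (auto intro!: tendsto_intros)
  have int_K: "integrable \<Lambda> (\<lambda>z. b * indicator K z)" for b :: real
    using K by (intro integrable_mult_right) (auto simp: less_top)
  have q_meas [measurable]: "q \<in> borel_measurable \<Lambda>"
    by (rule borel_measurable_LIMSEQ_real[OF q_lim])
       (use step_meas[of "\<lambda>i. (a m i)\<^sup>2 * expectation (vacant (Dm m i))" m for m] in \<open>simp add: p_def\<close>)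
  have q_bound: "\<bar>((a m (key m z))\<^sup>2 * p m z) * indicator K z\<bar> \<le> B\<^sup>2 * indicator K z" for m z
  proof (cases "z \<in> K")
    case True
    have "(a m (key m z))\<^sup>2 \<le> B\<^sup>2"
      using bound[OF True, of m] by (metis abs_ge_zero abs_le_square_iff abs_of_nonneg order_trans)
    then show ?thesis
      using True mult_mono[of "(a m (key m z))\<^sup>2" "B\<^sup>2" "p m z" 1] p_bounds[of m z] by simp
  qed simp
  have dc: "integrable \<Lambda> q \<and> (\<lambda>m. LINT z|\<Lambda>. ((a m (key m z))\<^sup>2 * p m z) * indicator K z) \<longlonglongrightarrow> integral\<^sup>L \<Lambda> q"
    by (intro conjI integrable_dominated_convergence[OF q_meas _ int_K[of "B\<^sup>2"] AE_I2[OF q_lim]]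
        integral_dominated_convergence[OF q_meas _ int_K[of "B\<^sup>2"] AE_I2[OF q_lim]])
       (use step_meas[of "\<lambda>i. (a m i)\<^sup>2 * expectation (vacant (Dm m i))" m for m] q_bound in
         \<open>auto simp: p_def\<close>)
  have q_nonneg: "0 \<le> q z" for z
    by (auto simp: q_def indicator_def vacant_bounds intro!: mult_nonneg_nonneg)
  define J where "J \<omega> = (\<Sum>j | Z j \<omega> \<in> K. \<phi> (Z j \<omega>) * vacant (D (Z j \<omega>)) \<omega>) -
      (LINT z:K|\<Lambda>. \<phi> z * vacant (D z) \<omega>)" for \<omega>
  have X_lim: "AE \<omega> in M. (\<lambda>m. X m \<omega>) \<longlonglongrightarrow> J \<omega>"
    using AE_point_count_finite[OF K] AE_space
  proof eventually_elim
    case (elim \<omega>)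
    note nf = num_finite_points[OF elim(1)]
    let ?u = "\<lambda>m i. a m i * vacant (Dm m i) \<omega>"
    have X_eq: "X m \<omega> = (\<Sum>j | Z j \<omega> \<in> K. ?u m (key m (Z j \<omega>))) - (LINT z|\<Lambda>. ?u m (key m z) * indicator K z)" for m
    proof -
      have "(\<Sum>i\<in>I m. ?u m i * num (c m i) \<omega>) =
        (\<Sum>j | Z j \<omega> \<in> K. \<Sum>i\<in>I m. ?u m i * indicator (c m i) (Z j \<omega>))"
        by (subst sum.swap) (simp add: nf(2)[OF c(2)] sum_distrib_left)
      also have "\<dots> = (\<Sum>j | Z j \<omega> \<in> K. ?u m (key m (Z j \<omega>)))"
        unfolding step[of "?u m", symmetric] by (intro sum.cong) auto
      finally show ?thesis
        using step_int[of "?u m" m] by (simp add: X_def right_diff_distrib sum_subtractf)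
    qed
    have u_lim: "(\<lambda>m. ?u m (key m z)) \<longlonglongrightarrow> \<phi> z * vacant (D z) \<omega>" if "z \<in> K" for z
      using that lim vac_lim elim by (intro tendsto_mult) auto
    have u_lim': "(\<lambda>m. ?u m (key m z) * indicator K z) \<longlonglongrightarrow> indicator K z *\<^sub>R (\<phi> z * vacant (D z) \<omega>)" for z
      using u_lim[of z] by (cases "z \<in> K") auto
    have "(\<lambda>m. LINT z|\<Lambda>. ?u m (key m z) * indicator K z) \<longlonglongrightarrow> (LINT z:K|\<Lambda>. \<phi> z * vacant (D z) \<omega>)"
      unfolding set_lebesgue_integral_def
    proof (rule integral_dominated_convergence[OF _ _ int_K[of B] AE_I2[OF u_lim']])
      show "(\<lambda>z. indicator K z *\<^sub>R (\<phi> z * vacant (D z) \<omega>)) \<in> borel_measurable \<Lambda>"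
        by (rule borel_measurable_LIMSEQ_real[OF u_lim' step_meas])
      show "AE z in \<Lambda>. norm (?u m (key m z) * indicator K z) \<le> B * indicator K z" for m
      proof (rule AE_I2)
        fix z
        show "norm (?u m (key m z) * indicator K z) \<le> B * indicator K z"
          using bound[of z m] mult_mono[of "\<bar>a m (key m z)\<bar>" B "vacant (Dm m (key m z)) \<omega>" 1]
          by (cases "z \<in> K") (auto simp: vacant_bounds abs_mult)
      qed
    qed (rule step_meas)
    moreover have "(\<lambda>m. \<Sum>j | Z j \<omega> \<in> K. ?u m (key m (Z j \<omega>))) \<longlonglongrightarrow>
        (\<Sum>j | Z j \<omega> \<in> K. \<phi> (Z j \<omega>) * vacant (D (Z j \<omega>)) \<omega>)"
      by (intro tendsto_sum u_lim) auto
    ultimately show ?case unfolding X_eq J_def by (rule tendsto_diff[rotated])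
  qed
  \<comment> \<open>Measurability of \<open>J\<close> is not established directly;
    \<open>lim\<close> yields a measurable function that agrees with it almost surely.\<close>
  define L where "L \<omega> = lim (\<lambda>m. X m \<omega>)" for \<omega>
  have L_meas: "L \<in> borel_measurable M"
    unfolding L_def by (rule borel_measurable_lim_metric) measurable
  have L_eq: "AE \<omega> in M. L \<omega> = J \<omega>"
    using X_lim by eventually_elim (auto simp: L_def intro: limI)
  have "(\<integral>\<^sup>+\<omega>. ennreal ((L \<omega>)\<^sup>2) \<partial>M) \<le> (\<integral>\<^sup>+\<omega>. liminf (\<lambda>m. ennreal ((X m \<omega>)\<^sup>2)) \<partial>M)"
  proof (rule nn_integral_mono_AE)
    show "AE \<omega> in M. ennreal ((L \<omega>)\<^sup>2) \<le> liminf (\<lambda>m. ennreal ((X m \<omega>)\<^sup>2))"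
      using X_lim L_eq
    proof eventually_elim
      case (elim \<omega>)
      from elim(1) have "(\<lambda>m. ennreal ((X m \<omega>)\<^sup>2)) \<longlonglongrightarrow> ennreal ((J \<omega>)\<^sup>2)"
        by (intro tendsto_intros)
      then have *: "liminf (\<lambda>m. ennreal ((X m \<omega>)\<^sup>2)) = ennreal ((J \<omega>)\<^sup>2)"
        by (rule lim_imp_Liminf[rotated]) simp
      show ?case unfolding elim(2) * by simp
    qed
  qed
  also have "\<dots> \<le> liminf (\<lambda>m. \<integral>\<^sup>+\<omega>. ennreal ((X m \<omega>)\<^sup>2) \<partial>M)"
    by (rule nn_integral_liminf) measurable
  also have "\<dots> = ennreal (integral\<^sup>L \<Lambda> q)"
    unfolding X_moment using dc by (intro lim_imp_Liminf tendsto_intros) auto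
  also have "\<dots> = (\<integral>\<^sup>+z. ennreal (q z) \<partial>\<Lambda>)"
    using dc q_nonneg by (intro nn_integral_eq_integral[symmetric]) auto
  also have "\<dots> = (\<integral>\<^sup>+z. ennreal ((\<phi> z)\<^sup>2 * expectation (vacant (D z))) * indicator K z \<partial>\<Lambda>)"
    by (intro nn_integral_cong) (auto simp: q_def indicator_def)
  finally show ?thesis
    using that L_meas L_eq unfolding J_def by blast
qed

end

section \<open>Hoelder cones and the leading constant\<close>

text \<open>After division by s + t both summands lie in [0,1] and add up to 1, and an exponent at
  most 1 only enlarges numbers in that range.\<close>

lemma powr_add_le:
  fixes s t \<beta> :: real
  assumes "0 \<le> s" "0 \<le> t" "0 < \<beta>" "\<beta> \<le> 1"
  shows "(s + t) powr \<beta> \<le> s powr \<beta> + t powr \<beta>"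
proof (cases "s + t = 0")
  case False
  then have st: "0 < s + t" using assms by auto
  have *: "u / (s + t) \<le> (u / (s + t)) powr \<beta>" if "0 \<le> u" "u \<le> s + t" for u
  proof -
    have "(u / (s + t)) powr 1 \<le> (u / (s + t)) powr \<beta>"
      using that st assms by (intro powr_mono') auto
    then show ?thesis using that st by simp
  qed
  have "1 = s / (s + t) + t / (s + t)" using st by (simp add: add_divide_distrib[symmetric])
  also have "\<dots> \<le> (s / (s + t)) powr \<beta> + (t / (s + t)) powr \<beta>"
    using assms by (intro add_mono *) auto
  also have "\<dots> = (s powr \<beta> + t powr \<beta>) / (s + t) powr \<beta>"
    using assms st by (simp add: powr_divide add_divide_distrib)
  finally show ?thesis using st by (simp add: field_simps)
qed (use assms in auto)

text \<open>Thus \<open>\<bar>x - y\<bar> powr \<beta>\<close> is a metric on the reals. The Hoelder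
  property of the estimated curve and the comparison of cones with nearby apices both rest on
  this.\<close>

lemma abs_diff_powr_triangle:
  fixes x y z \<beta> :: real
  assumes "0 < \<beta>" "\<beta> \<le> 1"
  shows "\<bar>x - z\<bar> powr \<beta> \<le> \<bar>x - y\<bar> powr \<beta> + \<bar>y - z\<bar> powr \<beta>"
proof -
  have "\<bar>x - z\<bar> powr \<beta> \<le> (\<bar>x - y\<bar> + \<bar>y - z\<bar>) powr \<beta>"
    using assms by (intro powr_mono2) auto
  also have "\<dots> \<le> \<bar>x - y\<bar> powr \<beta> + \<bar>y - z\<bar> powr \<beta>"
    using assms by (intro powr_add_le) auto
  finally show ?thesis .
qed

section \<open>Exponential and Gamma integrals\<close>

lemma nn_integral_exp_tail:
  fixes k a :: real
  assumes "0 < k"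
  shows "(\<integral>\<^sup>+t. ennreal (exp (- k * t)) * indicator {a..} t \<partial>lborel) = ennreal (exp (- k * a) / k)"
proof -
  have "((\<lambda>t. - (exp (- k * t) / k)) \<longlongrightarrow> - (0 / k)) at_top"
    using assms
    by (intro tendsto_intros filterlim_compose[OF exp_at_bot] filterlim_tendsto_neg_mult_at_bot[of _ "-k"] filterlim_ident) auto
  then have "(\<integral>\<^sup>+t. ennreal (exp (- k * t)) * indicator {a..} t \<partial>lborel) = ennreal (- (0 / k) - (- (exp (- k * a) / k)))"
    using assms by (intro nn_integral_FTC_atLeast) (auto intro!: derivative_eq_intros)
  then show ?thesis by simp
qed

text \<open>A layer-cake argument replaces the substitution: exp(-a) is the integral of exp(-s) over
  s \<ge> a, and after exchanging the integrals the t-section is [0, (s/c)^(1/p)], whose length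
  weighted by exp(-s) is the integrand of Gamma(1 + 1/p) up to the factor c^(-1/p).\<close>

lemma nn_integral_exp_neg_powr:
  fixes c p :: real
  assumes "0 < c" "0 < p"
  shows "(\<integral>\<^sup>+t. ennreal (exp (- (c * t powr p))) * indicator {0..} t \<partial>lborel) =
    ennreal (Gamma (1 + 1 / p) * c powr (- 1 / p))"
proof -
  have le_iff: "c * t powr p \<le> s \<longleftrightarrow> t \<le> (s / c) powr (1 / p)" if "0 \<le> t" "0 \<le> s" for s t
  proof -
    have "t \<le> (s / c) powr (1 / p) \<longleftrightarrow> t powr p \<le> ((s / c) powr (1 / p)) powr p"
      using assms that powr_mono2[of p t "(s / c) powr (1 / p)"] powr_less_mono2[of p "(s / c) powr (1 / p)" t]
      by (smt (verit) powr_ge_zero)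
    also have "\<dots> \<longleftrightarrow> t powr p \<le> s / c" using assms that by (simp add: powr_powr)
    finally show ?thesis using assms by (simp add: field_simps)
  qed
  have "(\<integral>\<^sup>+t. ennreal (exp (- (c * t powr p))) * indicator {0..} t \<partial>lborel) =
    (\<integral>\<^sup>+t. (\<integral>\<^sup>+s. ennreal (exp (- s)) * (of_bool (0 \<le> t \<and> c * t powr p \<le> s)) \<partial>lborel) \<partial>lborel)"
  proof (rule nn_integral_cong)
    fix t :: real
    have "(\<integral>\<^sup>+s. ennreal (exp (- s)) * (of_bool (0 \<le> t \<and> c * t powr p \<le> s)) \<partial>lborel) =
      (\<integral>\<^sup>+s. ennreal (exp (- 1 * s)) * indicator {c * t powr p..} s * indicator {0..} t \<partial>lborel)"
      by (intro nn_integral_cong) (auto simp: indicator_def)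
    also have "\<dots> = ennreal (exp (- (c * t powr p))) * indicator {0..} t"
      using nn_integral_exp_tail[of 1 "c * t powr p"] by (subst nn_integral_multc) auto
    finally show "ennreal (exp (- (c * t powr p))) * indicator {0..} t =
      (\<integral>\<^sup>+s. ennreal (exp (- s)) * (of_bool (0 \<le> t \<and> c * t powr p \<le> s)) \<partial>lborel)" ..
  qed
  also have "\<dots> = (\<integral>\<^sup>+s. (\<integral>\<^sup>+t. ennreal (exp (- s)) * (of_bool (0 \<le> t \<and> c * t powr p \<le> s)) \<partial>lborel) \<partial>lborel)"
    by (rule lborel_pair.Fubini') measurable
  also have "\<dots> = (\<integral>\<^sup>+s. ennreal (c powr (- 1 / p)) * ennreal (indicator {0..} s * s powr ((1 + 1 / p) - 1) / exp s) \<partial>lborel)"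
  proof (rule nn_integral_cong)
    fix s :: real
    have "(\<integral>\<^sup>+t. ennreal (exp (- s)) * (of_bool (0 \<le> t \<and> c * t powr p \<le> s)) \<partial>lborel) =
      (\<integral>\<^sup>+t. (ennreal (exp (- s)) * indicator {0..} s) * indicator {0..(s / c) powr (1 / p)} t \<partial>lborel)"
    proof (rule nn_integral_cong)
      fix t :: real
      have "0 \<le> s" if "c * t powr p \<le> s"
        using that assms by (meson less_le_not_le mult_nonneg_nonneg order_trans powr_ge_zero)
      then show "ennreal (exp (- s)) * (of_bool (0 \<le> t \<and> c * t powr p \<le> s)) =
        (ennreal (exp (- s)) * indicator {0..} s) * indicator {0..(s / c) powr (1 / p)} t"
        using le_iff[of t s] by (auto simp: indicator_def)
    qed
    also have "\<dots> = (ennreal (exp (- s)) * indicator {0..} s) * ennreal ((s / c) powr (1 / p))"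
      by (subst nn_integral_cmult_indicator) auto
    also have "\<dots> = ennreal (c powr (- 1 / p)) * ennreal (indicator {0..} s * s powr ((1 + 1 / p) - 1) / exp s)"
      using assms by (auto simp: indicator_def powr_divide powr_minus exp_minus field_simps simp flip: ennreal_mult)
    finally show "(\<integral>\<^sup>+t. ennreal (exp (- s)) * (of_bool (0 \<le> t \<and> c * t powr p \<le> s)) \<partial>lborel) = \<dots>" .
  qed
  also have "\<dots> = ennreal (c powr (- 1 / p)) * ennreal (Gamma (1 + 1 / p))"
    using assms Gamma_conv_nn_integral_real[of "1 + 1 / p"] by (subst nn_integral_cmult) (auto simp: add_pos_pos)
  finally show ?thesis by (simp only: mult.commute ennreal_mult'' powr_ge_zero)
qed

text \<open>A lower bound for the one-sided area between curve and cone when the apex is t above the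
  curve. The minimum r is a width on which t - 2R s^\<beta> is nonnegative, capped at 1/2 because
  every x in [0,1] has that much room on one side. Uncapped, 2R r^\<beta> = t and the area t r - 2R
  r^(\<beta> + 1)/(\<beta> + 1) equals t r \<beta>/(\<beta> + 1); capped, 2R r^\<beta> \<le> t and
  the latter is a lower bound.\<close>

definition rate :: "real \<Rightarrow> real \<Rightarrow> real \<Rightarrow> real" where
  "rate \<beta> R t = t * min (1 / 2) ((t / (2 * R)) powr (1 / \<beta>)) * (\<beta> / (\<beta> + 1))"

lemma area_ge_rate:
  fixes \<beta> R t x :: real
  assumes "0 < \<beta>" "0 < R" "0 \<le> t" "x \<in> {0..1}"
  shows "ennreal (rate \<beta> R t) \<le>
    (\<integral>\<^sup>+u. ennreal (t - 2 * R * \<bar>x - u\<bar> powr \<beta>) * indicator {0..1} u \<partial>lborel)"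
proof -
  define r where "r = min (1 / 2) ((t / (2 * R)) powr (1 / \<beta>))"
  have r: "0 \<le> r" "r \<le> 1 / 2" by (auto simp: r_def)
  have "r powr \<beta> \<le> ((t / (2 * R)) powr (1 / \<beta>)) powr \<beta>"
    using assms r(1) by (intro powr_mono2) (auto simp: r_def)
  then have "r powr \<beta> \<le> t / (2 * R)" using assms by (simp add: powr_powr)
  then have rt: "2 * R * r powr \<beta> \<le> t" using assms by (simp add: field_simps)
  have nonneg: "0 \<le> t - 2 * R * s powr \<beta>" if "s \<in> {0..r}" for s
  proof -
    have "2 * R * s powr \<beta> \<le> 2 * R * r powr \<beta>"
      using that assms by (intro mult_left_mono powr_mono2) auto
    then show ?thesis using rt by simp
  qed
  have I: "((\<lambda>s. t - 2 * R * s powr \<beta>) has_integral (t * r - 2 * R * (r powr (\<beta> + 1) / (\<beta> + 1)))) {0..r}"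
    using has_integral_powr_from_0[of \<beta> r] has_integral_const_real[of t 0 r] assms r
    by (intro has_integral_diff has_integral_mult_right) (auto simp: mult.commute)
  have "rate \<beta> R t = t * r - t * r / (\<beta> + 1)"
  proof -
    have "rate \<beta> R t = t * r * (\<beta> / (\<beta> + 1))" by (simp only: rate_def r_def)
    then show ?thesis using assms by (simp add: field_simps)
  qed
  also have "\<dots> \<le> t * r - 2 * R * (r powr (\<beta> + 1) / (\<beta> + 1))"
  proof -
    have "2 * R * r powr (\<beta> + 1) = (2 * R * r powr \<beta>) * r" using r by (simp add: powr_add)
    also have "\<dots> \<le> t * r" using rt r by (intro mult_right_mono) auto
    finally show ?thesis using assms by (simp add: divide_right_mono)
  qed
  finally have "ennreal (rate \<beta> R t) \<le> ennreal (t * r - 2 * R * (r powr (\<beta> + 1) / (\<beta> + 1)))"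
    by (rule ennreal_leI)
  also have "\<dots> = (\<integral>\<^sup>+s. ennreal (t - 2 * R * s powr \<beta>) * indicator {0..r} s \<partial>lborel)"
    by (rule nn_integral_has_integral_lebesgue'[symmetric, OF nonneg I])
  also have "\<dots> \<le> (\<integral>\<^sup>+u. ennreal (t - 2 * R * \<bar>x - u\<bar> powr \<beta>) * indicator {0..1} u \<partial>lborel)"
  \<comment> \<open>For x \<le> 1/2 the interval [x, x + r] stays in [0,1], otherwise [x - r, x]
    does; u = x + s and u = x - s reduce both to [0, r].\<close>
  proof (cases "x \<le> 1 / 2")
    case True
    have "(\<integral>\<^sup>+u. ennreal (t - 2 * R * \<bar>x - u\<bar> powr \<beta>) * indicator {0..1} u \<partial>lborel) =
      ennreal \<bar>1\<bar> * (\<integral>\<^sup>+s. ennreal (t - 2 * R * \<bar>x - (x + 1 * s)\<bar> powr \<beta>) * indicator {0..1} (x + 1 * s) \<partial>lborel)"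
      by (rule nn_integral_real_affine) auto
    moreover have "(\<integral>\<^sup>+s. ennreal (t - 2 * R * s powr \<beta>) * indicator {0..r} s \<partial>lborel) \<le>
      (\<integral>\<^sup>+s. ennreal (t - 2 * R * \<bar>x - (x + 1 * s)\<bar> powr \<beta>) * indicator {0..1} (x + 1 * s) \<partial>lborel)"
      using True assms r by (intro nn_integral_mono) (simp add: indicator_def)
    ultimately show ?thesis by simp
  next
    case False
    have "(\<integral>\<^sup>+u. ennreal (t - 2 * R * \<bar>x - u\<bar> powr \<beta>) * indicator {0..1} u \<partial>lborel) =
      ennreal \<bar>-1\<bar> * (\<integral>\<^sup>+s. ennreal (t - 2 * R * \<bar>x - (x + -1 * s)\<bar> powr \<beta>) * indicator {0..1} (x + -1 * s) \<partial>lborel)"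
      by (rule nn_integral_real_affine) auto
    moreover have "(\<integral>\<^sup>+s. ennreal (t - 2 * R * s powr \<beta>) * indicator {0..r} s \<partial>lborel) \<le>
      (\<integral>\<^sup>+s. ennreal (t - 2 * R * \<bar>x - (x + -1 * s)\<bar> powr \<beta>) * indicator {0..1} (x + -1 * s) \<partial>lborel)"
      using False assms r by (intro nn_integral_mono) (simp add: indicator_def)
    ultimately show ?thesis by simp
  qed
  finally show ?thesis .
qed

lemma rate_nonneg: "0 < \<beta> \<Longrightarrow> 0 \<le> t \<Longrightarrow> 0 \<le> rate \<beta> R t"
  unfolding rate_def by (intro mult_nonneg_nonneg) auto

lemma rate_measurable [measurable]: "rate \<beta> R \<in> borel_measurable borel"
  unfolding rate_def[abs_def] by measurable

text \<open>The threshold on t is where (t/(2R))^(1/\<beta>) reaches 1/2. Up to it the cap is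
  inactive, and the rate is the pure power behind the Gamma integral.\<close>

lemma rate_small:
  fixes \<beta> R t :: real
  assumes "0 < \<beta>" "0 < R" "0 \<le> t" "t \<le> 2 * R * (1 / 2) powr \<beta>"
  shows "rate \<beta> R t = \<beta> / (\<beta> + 1) * (2 * R) powr (- 1 / \<beta>) * t powr ((\<beta> + 1) / \<beta>)"
proof -
  have "(t / (2 * R)) powr (1 / \<beta>) \<le> ((1 / 2) powr \<beta>) powr (1 / \<beta>)"
    using assms by (intro powr_mono2) (auto simp: field_simps)
  also have "\<dots> = 1 / 2" using assms by (simp only: powr_powr) simp
  finally have "rate \<beta> R t = t * (t / (2 * R)) powr (1 / \<beta>) * (\<beta> / (\<beta> + 1))"
    by (simp add: rate_def min_absorb2)
  also have "\<dots> = \<beta> / (\<beta> + 1) * (2 * R) powr (- 1 / \<beta>) * (t * t powr (1 / \<beta>))"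
  proof -
    have "(t / (2 * R)) powr (1 / \<beta>) = t powr (1 / \<beta>) * (2 * R) powr (- 1 / \<beta>)"
      using assms powr_divide[of t "2 * R" "1 / \<beta>"] powr_minus_divide[of "2 * R" "1 / \<beta>"] by simp
    then show ?thesis by (simp only: mult_ac)
  qed
  also have "t * t powr (1 / \<beta>) = t powr (1 + 1 / \<beta>)"
    using assms by (simp add: powr_add)
  also have "1 + 1 / \<beta> = (\<beta> + 1) / \<beta>"
    using assms by (simp add: add_divide_distrib)
  finally show ?thesis .
qed

text \<open>The width does not decrease in t, so beyond \<open>\<tau>\<close> the rate grows at
  least linearly. For large n this beats the growth exp(2 C t) of the squared derivative.\<close>

lemma rate_large:
  fixes \<beta> R t \<tau> :: real
  assumes "0 < \<beta>" "0 < R" "0 \<le> \<tau>" "\<tau> \<le> t"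
  shows "t * (min (1 / 2) ((\<tau> / (2 * R)) powr (1 / \<beta>)) * (\<beta> / (\<beta> + 1))) \<le> rate \<beta> R t"
proof -
  have "(\<tau> / (2 * R)) powr (1 / \<beta>) \<le> (t / (2 * R)) powr (1 / \<beta>)"
    using assms by (intro powr_mono2) (auto simp: field_simps)
  then show ?thesis
    unfolding rate_def mult.assoc using assms by (intro mult_left_mono mult_right_mono) auto
qed

text \<open>Since 1 - q = 1/(\<beta> + 1), the factor q of Gamma(1 + q) = q Gamma(q) merges with
  q^(-q) into q^(1/(\<beta> + 1)), and (2R)^(q/\<beta>) is (2R)^(1/(\<beta> + 1)). The result is the
  constant of the theorem.\<close>

lemma leading_constant:
  fixes \<beta> R n q :: real
  assumes "0 < \<beta>" "0 < R" "0 < n" and q_def: "q = \<beta> / (\<beta> + 1)"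
  shows "n powr q * (Gamma (1 + q) * (n * (q * (2 * R) powr (- 1 / \<beta>))) powr (- q)) =
    Gamma q * (2 * R * q) powr (1 / (\<beta> + 1))"
proof -
  have q: "0 < q" "1 + - q = 1 / (\<beta> + 1)" using assms(1) unfolding q_def by (auto simp: field_simps)
  have "- 1 / \<beta> * - q = 1 / (\<beta> + 1)" using assms by simp
  then have "((2 * R) powr (- 1 / \<beta>)) powr (- q) = (2 * R) powr (1 / (\<beta> + 1))"
    by (simp only: powr_powr)
  then have "(n * (q * (2 * R) powr (- 1 / \<beta>))) powr (- q) =
      n powr (- q) * (q powr (- q) * (2 * R) powr (1 / (\<beta> + 1)))"
    using assms(1-3) q by (simp only: powr_mult)
  moreover have "Gamma (1 + q) = q * Gamma q"
    using q(1) Gamma_plus1[of q] by (simp add: add.commute nonpos_Ints_def)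
  ultimately have "n powr q * (Gamma (1 + q) * (n * (q * (2 * R) powr (- 1 / \<beta>))) powr (- q)) =
    (n powr q * n powr (- q)) * (q * q powr (- q)) * (Gamma q * (2 * R) powr (1 / (\<beta> + 1)))"
    by (simp only: mult_ac)
  also have "n powr q * n powr (- q) = 1" using assms(3) by (simp flip: powr_add)
  also have "q * q powr (- q) = q powr (1 / (\<beta> + 1))"
    using q powr_add[of q 1 "- q"] by simp
  finally show ?thesis
    by (simp only: powr_mult mult_ac mult_1_right)
qed

section \<open>The boundary model\<close>

text \<open>Members of the Hoelder ball are arbitrary outside [0,1] and need not be Borel there.
  Composition with this projection gives a representative that is continuous on the whole
  line.\<close>

definition clamp01 :: "real \<Rightarrow> real" where
  "clamp01 x = max 0 (min 1 x)"

lemma clamp01_in [simp]: "clamp01 x \<in> {0..1}"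
  and clamp01_bounds [simp]: "0 \<le> clamp01 x" "clamp01 x \<le> 1"
  and clamp01_id [simp]: "0 \<le> x \<Longrightarrow> x \<le> 1 \<Longrightarrow> clamp01 x = x"
  by (auto simp: clamp01_def)

lemma clamp01_continuous: "continuous_on A clamp01"
  unfolding clamp01_def by (intro continuous_intros)

lemma hoelder_ballD:
  "g \<in> hoelder_ball \<beta> R \<Longrightarrow> x \<in> {0..1} \<Longrightarrow> y \<in> {0..1} \<Longrightarrow> \<bar>g x - g y\<bar> \<le> R * \<bar>x - y\<bar> powr \<beta>"
  by (auto simp: hoelder_ball_def)

lemma hoelder_ball_continuous:
  assumes g: "g \<in> hoelder_ball \<beta> R" and "0 < \<beta>" "0 < R"
  shows "continuous_on {0..1} g"
  unfolding continuous_on_iff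
proof (intro ballI allI impI)
  fix x e :: real assume x: "x \<in> {0..1}" and e: "0 < e"
  show "\<exists>d>0. \<forall>x'\<in>{0..1}. dist x' x < d \<longrightarrow> dist (g x') (g x) < e"
  proof (intro exI[of _ "(e / R) powr (1 / \<beta>)"] conjI ballI impI)
    show "0 < (e / R) powr (1 / \<beta>)" using assms e by simp
    fix x' assume x': "x' \<in> {0..1}" and d: "dist x' x < (e / R) powr (1 / \<beta>)"
    have "\<bar>x' - x\<bar> powr \<beta> < ((e / R) powr (1 / \<beta>)) powr \<beta>"
      using d assms by (intro powr_less_mono2) (auto simp: dist_real_def)
    also have "\<dots> = e / R" using assms e by (simp add: powr_powr)
    finally have "R * \<bar>x' - x\<bar> powr \<beta> < e" using assms by (simp add: field_simps)
    then show "dist (g x') (g x) < e"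
      using hoelder_ballD[OF g x' x] by (simp add: dist_real_def)
  qed
qed

lemma hoelder_ball_clamp_continuous:
  assumes "g \<in> hoelder_ball \<beta> R" "0 < \<beta>" "0 < R"
  shows "continuous_on UNIV (\<lambda>x. g (clamp01 x))"
  by (rule continuous_on_compose2[OF hoelder_ball_continuous[OF assms] clamp01_continuous]) auto

lemma hoelder_ball_clamp_measurable:
  assumes "g \<in> hoelder_ball \<beta> R" "0 < \<beta>" "0 < R"
  shows "(\<lambda>x. g (clamp01 x)) \<in> borel_measurable borel"
  by (rule borel_measurable_continuous_onI[OF hoelder_ball_clamp_continuous[OF assms]])

lemma hoelder_ball_osc:
  assumes "g \<in> hoelder_ball \<beta> R" "0 < \<beta>" "0 < R" "x \<in> {0..1}" "y \<in> {0..1}"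
  shows "\<bar>g x - g y\<bar> \<le> R"
proof -
  have "\<bar>x - y\<bar> powr \<beta> \<le> 1 powr \<beta>" using assms by (intro powr_mono2) auto
  then have "R * \<bar>x - y\<bar> powr \<beta> \<le> R" using assms by simp
  then show ?thesis using hoelder_ballD[OF assms(1,4,5)] by simp
qed

section \<open>Weak derivatives and iterated integrals\<close>

lemma weak_derivative_measurable:
  assumes "has_weak_derivative \<Phi> \<Phi>'"
  shows "\<Phi>' \<in> borel_measurable borel"
proof (rule borel_measurable_LIMSEQ_real)
  have "set_borel_measurable lborel {- real m..real m} \<Phi>'" for m
    using assms unfolding has_weak_derivative_def set_integrable_def set_borel_measurable_def by blast
  then show "(\<lambda>x. indicator {- real m..real m} x *\<^sub>R \<Phi>' x) \<in> borel_measurable borel" for m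
    by (simp add: set_borel_measurable_def)
  fix x :: real
  have "\<forall>\<^sub>F m in sequentially. \<bar>x\<bar> \<le> real m"
    using eventually_ge_at_top[of "nat \<lceil>\<bar>x\<bar>\<rceil>"] by eventually_elim linarith
  then have "\<forall>\<^sub>F m in sequentially. indicator {- real m..real m} x *\<^sub>R \<Phi>' x = \<Phi>' x"
    by eventually_elim (auto simp: indicator_def)
  then show "(\<lambda>m. indicator {- real m..real m} x *\<^sub>R \<Phi>' x) \<longlonglongrightarrow> \<Phi>' x"
    by (rule tendsto_eventually)
qed

lemma weak_derivative_diff:
  assumes "has_weak_derivative \<Phi> \<Phi>'" "a \<le> b"
  shows "\<Phi> b - \<Phi> a = (LBINT v:{a..b}. \<Phi>' v)"
proof -
  have si: "set_integrable lborel {a<..<b} \<Phi>'" for a b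
  proof -
    have "set_integrable lborel {a..b} \<Phi>'" using assms(1) unfolding has_weak_derivative_def by blast
    then show ?thesis by (rule set_integrable_subset) auto
  qed
  have int: "interval_lebesgue_integrable lborel (ereal a) (ereal b) \<Phi>'" for a b
    using si unfolding interval_lebesgue_integrable_def by auto
  have "(LBINT v=ereal 0..ereal a. \<Phi>' v) + (LBINT v=ereal a..ereal b. \<Phi>' v) = (LBINT v=ereal 0..ereal b. \<Phi>' v)"
    using int by (intro interval_integral_sum) (metis min_def max_def ereal_min ereal_max)
  moreover have "\<Phi> b = \<Phi> 0 + (LBINT v=ereal 0..ereal b. \<Phi>' v)" "\<Phi> a = \<Phi> 0 + (LBINT v=ereal 0..ereal a. \<Phi>' v)"
    using assms(1) unfolding has_weak_derivative_def by blast+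
  ultimately have "\<Phi> b - \<Phi> a = (LBINT v=ereal a..ereal b. \<Phi>' v)" by linarith
  then show ?thesis using assms(2) by (simp add: interval_integral_Icc)
qed

lemma weak_derivative_continuous:
  assumes "has_weak_derivative \<Phi> \<Phi>'"
  shows "continuous_on UNIV \<Phi>"
proof -
  have "continuous_on {- r<..<r} \<Phi>" for r :: real
  proof -
    have si: "set_integrable lborel {a..b} \<Phi>'" for a b
      using assms unfolding has_weak_derivative_def by blast
    have "continuous_on {- r..r} (\<lambda>u. \<Phi> (- r) + integral {- r..u} \<Phi>')"
      by (intro continuous_intros indefinite_integral_continuous_1 set_borel_integral_eq_integral(1) si)
    moreover have "\<Phi> (- r) + integral {- r..u} \<Phi>' = \<Phi> u" if "u \<in> {- r..r}" for u
      using weak_derivative_diff[OF assms, of "- r" u] that set_borel_integral_eq_integral(2)[OF si] by simp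
    ultimately have "continuous_on {- r..r} \<Phi>" by (rule continuous_on_eq) auto
    then show ?thesis by (rule continuous_on_subset) auto
  qed
  then have "continuous_on (\<Union>r. {- r<..<r}) \<Phi>"
    by (intro continuous_on_open_UN) auto
  moreover have "(\<Union>r. {- r<..<r}) = (UNIV :: real set)"
  proof (intro set_eqI iffI UNIV_I)
    fix x :: real show "x \<in> (\<Union>r. {- r<..<r})" by (intro UN_I[of "\<bar>x\<bar> + 1"]) auto
  qed
  ultimately show ?thesis by simp
qed

lemma nn_integral_lborel_prod:
  fixes F :: "real \<times> real \<Rightarrow> ennreal"
  assumes "F \<in> borel_measurable borel"
  shows "(\<integral>\<^sup>+z. F z \<partial>lborel) = (\<integral>\<^sup>+x. \<integral>\<^sup>+y. F (x, y) \<partial>lborel \<partial>lborel)"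
  using lborel.nn_integral_fst[of F lborel] assms by (simp add: lborel_prod)

text \<open>The almost sure property under which everything about the estimated curve is proved for
  a fixed point sequence, free of probability.\<close>

definition good_points :: "(real \<Rightarrow> real) \<Rightarrow> (nat \<Rightarrow> real \<times> real) \<Rightarrow> bool" where
  "good_points g z \<longleftrightarrow> (\<forall>k. fst (z k) \<in> {0..1} \<and> g (fst (z k)) \<le> snd (z k))"

section \<open>Geometry of the maximum-likelihood curve\<close>

context
  fixes \<beta> R :: real and g :: "real \<Rightarrow> real" and z :: "nat \<Rightarrow> real \<times> real"
  assumes \<beta>: "0 < \<beta>" "\<beta> \<le> 1" and R: "0 < R" and g: "g \<in> hoelder_ball \<beta> R"
    and z: "good_points g z"
begin

lemma mle_terms_ge:
  assumes "x \<in> {0..1}"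
  shows "g x \<le> snd (z k) + R * \<bar>x - fst (z k)\<bar> powr \<beta>"
  using z hoelder_ballD[OF g assms, of "fst (z k)"] unfolding good_points_def by smt

lemma le_mle_iff:
  assumes "x \<in> {0..1}"
  shows "y \<le> mle \<beta> R z x \<longleftrightarrow> (\<forall>k. y \<le> snd (z k) + R * \<bar>x - fst (z k)\<bar> powr \<beta>)"
  unfolding mle_def using mle_terms_ge[OF assms]
  by (subst le_cINF_iff) (auto intro!: bdd_belowI2)

lemma mle_le: "x \<in> {0..1} \<Longrightarrow> mle \<beta> R z x \<le> snd (z k) + R * \<bar>x - fst (z k)\<bar> powr \<beta>"
  using le_mle_iff[of x "mle \<beta> R z x"] by simp

lemma le_mle: "x \<in> {0..1} \<Longrightarrow> g x \<le> mle \<beta> R z x"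
  using le_mle_iff mle_terms_ge by blast

text \<open>One point alone caps the estimated curve, since distances in [0,1] are at most 1. The
  cap supplies a truncation height for each realisation.\<close>

lemma mle_bounded: "x \<in> {0..1} \<Longrightarrow> mle \<beta> R z x \<le> snd (z 0) + R"
proof -
  assume x: "x \<in> {0..1}"
  have "\<bar>x - fst (z 0)\<bar> powr \<beta> \<le> 1 powr \<beta>"
    using x z \<beta> unfolding good_points_def by (intro powr_mono2) (auto simp: abs_le_iff intro: add_increasing2 dest!: spec[of _ 0])
  then have "R * \<bar>x - fst (z 0)\<bar> powr \<beta> \<le> R" using R by simp
  then show ?thesis using mle_le[OF x, of 0] by simp
qed

text \<open>An infimum of cones with a common modulus inherits the modulus; a one-sided inequality
  is enough because x and y can be swapped.\<close>

lemma mle_hoelder: "mle \<beta> R z \<in> hoelder_ball \<beta> R"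
proof -
  have "mle \<beta> R z x - R * \<bar>x - y\<bar> powr \<beta> \<le> mle \<beta> R z y" if "x \<in> {0..1}" "y \<in> {0..1}" for x y
    unfolding le_mle_iff[OF that(2)]
  proof
    fix k
    have "R * \<bar>x - fst (z k)\<bar> powr \<beta> \<le> R * (\<bar>x - y\<bar> powr \<beta> + \<bar>y - fst (z k)\<bar> powr \<beta>)"
      using abs_diff_powr_triangle[OF \<beta>] R by (intro mult_left_mono) auto
    then show "mle \<beta> R z x - R * \<bar>x - y\<bar> powr \<beta> \<le> snd (z k) + R * \<bar>y - fst (z k)\<bar> powr \<beta>"
      using mle_le[OF that(1), of k] by (simp add: algebra_simps)
  qed
  then show ?thesis
    unfolding hoelder_ball_def by (smt (verit) abs_minus_commute mem_Collect_eq)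
qed

end

text \<open>The cone erected at a member \<open>w\<close> passes strictly below \<open>z\<close>, so
  \<open>w\<close> alone pulls the estimated curve below \<open>z\<close>. Strictness matches the
  non-strict inequality in \<open>estimator\<close>; the restriction to the strip places the region
  in the \<sigma>-algebra of the intensity.\<close>

definition below :: "real \<Rightarrow> real \<Rightarrow> real \<times> real \<Rightarrow> (real \<times> real) set" where
  "below \<beta> R z = {w \<in> {0..1} \<times> UNIV. snd w + R * \<bar>fst z - fst w\<bar> powr \<beta> < snd z}"

lemma below_borel: "below \<beta> R z \<in> sets borel"
proof -
  have [measurable]: "{0..1} \<times> UNIV \<in> sets (borel :: (real \<times> real) measure)"
    by (simp add: borel_closed closed_Times)
  have "below \<beta> R z = ({0..1} \<times> UNIV) \<inter>
      {w \<in> space borel. snd w + R * \<bar>fst z - fst w\<bar> powr \<beta> < snd z}"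
    by (auto simp: below_def)
  also have "\<dots> \<in> sets borel"
  proof (intro sets.Int)
    show "{w \<in> space borel. snd w + R * \<bar>fst z - fst w\<bar> powr \<beta> < snd z} \<in> sets borel"
      unfolding borel_prod[symmetric] by measurable
  qed measurable
  finally show ?thesis .
qed

locale boundary_model = poisson_point_process M "boundary_intensity n g" Z
  for M :: "'w measure" and n g Z +
  fixes \<beta> R :: real
  assumes n: "1 \<le> n" and \<beta>: "0 < \<beta>" "\<beta> \<le> 1" and R: "0 < R" and g: "g \<in> hoelder_ball \<beta> R"
begin

section \<open>The intensity measure in coordinates\<close>

abbreviation "\<Lambda> \<equiv> boundary_intensity n g"
definition G :: "real \<Rightarrow> real" where
  "G x = g (clamp01 x)"

lemma G_eq [simp]: "0 \<le> x \<Longrightarrow> x \<le> 1 \<Longrightarrow> G x = g x"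
  by (simp add: G_def)

lemma G_measurable [measurable]: "G \<in> borel_measurable borel"
  using hoelder_ball_clamp_measurable[OF g \<beta>(1) R] by (simp add: G_def[abs_def])

lemma strip_borel [measurable]: "{0..1} \<times> UNIV \<in> sets (borel :: (real \<times> real) measure)"
  by (simp add: borel_closed closed_Times)

text \<open>The density in \<open>boundary_intensity\<close> involves \<open>g\<close> on the whole
  line, where it need not be Borel. On the strip it coincides with one built from \<open>G\<close>,
  to which the integration rules for densities apply.\<close>

lemma intensity_eq:
  "\<Lambda> = density (restrict_space lborel ({0..1} \<times> UNIV)) (\<lambda>z. ennreal (real n * of_bool (G (fst z) \<le> snd z)))"
proof -
  have [measurable]: "(\<lambda>z. ennreal (real n * of_bool (G (fst z) \<le> snd z))) \<in> borel_measurable (borel :: (real \<times> real) measure)"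
    unfolding borel_prod[symmetric] by measurable
  have m: "(\<lambda>z. ennreal (real n * of_bool (G (fst z) \<le> snd z))) \<in>
      borel_measurable (restrict_space lborel ({0..1} \<times> UNIV))"
    by (rule measurable_restrict_space1) measurable
  have eq: "(\<lambda>(x, y). of_nat n * indicator {g x..} y) z = ennreal (real n * of_bool (G (fst z) \<le> snd z))"
    if "z \<in> space (restrict_space lborel ({0..1} \<times> UNIV))" for z
    using that by (auto simp: space_restrict_space indicator_def ennreal_of_nat_eq_real_of_nat)
  show ?thesis
    unfolding boundary_intensity_def
    by (rule density_cong[OF measurable_cong[THEN iffD2, OF eq m] m AE_I2[OF eq]])
qed

lemma space_intensity: "space \<Lambda> = {0..1} \<times> UNIV"
  by (simp add: boundary_intensity_def space_restrict_space)

lemma sets_intensity: "A \<in> sets \<Lambda> \<longleftrightarrow> A \<in> sets borel \<and> A \<subseteq> {0..1} \<times> UNIV"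
  by (auto simp: boundary_intensity_def sets_restrict_space_iff)

lemma nn_integral_intensity:
  assumes [measurable]: "F \<in> borel_measurable borel"
  shows "(\<integral>\<^sup>+z. F z \<partial>\<Lambda>) =
    (\<integral>\<^sup>+x. (\<integral>\<^sup>+y. of_nat n * F (x, y) * indicator {g x..} y \<partial>lborel) * indicator {0..1} x \<partial>lborel)"
proof -
  have [measurable]: "(\<lambda>z. ennreal (real n * of_bool (G (fst z) \<le> snd z))) \<in> borel_measurable (borel :: (real \<times> real) measure)"
    unfolding borel_prod[symmetric] by measurable
  have "(\<integral>\<^sup>+z. F z \<partial>\<Lambda>) =
    (\<integral>\<^sup>+z. ennreal (real n * of_bool (G (fst z) \<le> snd z)) * F z \<partial>restrict_space lborel ({0..1} \<times> UNIV))"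
    unfolding intensity_eq by (intro nn_integral_density measurable_restrict_space1) measurable
  also have "\<dots> = (\<integral>\<^sup>+z. ennreal (real n * of_bool (G (fst z) \<le> snd z)) * F z * indicator ({0..1} \<times> UNIV) z \<partial>lborel)"
    by (intro nn_integral_restrict_space) simp
  also have "\<dots> = (\<integral>\<^sup>+x. \<integral>\<^sup>+y. ennreal (real n * of_bool (G x \<le> y)) * F (x, y) * indicator ({0..1} \<times> UNIV) (x, y) \<partial>lborel \<partial>lborel)"
    by (subst nn_integral_lborel_prod) simp_all
  also have "\<dots> = (\<integral>\<^sup>+x. (\<integral>\<^sup>+y. of_nat n * F (x, y) * indicator {g x..} y \<partial>lborel) * indicator {0..1} x \<partial>lborel)"
    by (intro nn_integral_cong)
       (auto simp: indicator_def ennreal_of_nat_eq_real_of_nat intro!: nn_integral_cong)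
  finally show ?thesis .
qed

lemma emeasure_intensity:
  assumes "A \<in> sets borel" "A \<subseteq> {0..1} \<times> UNIV"
  shows "emeasure \<Lambda> A = (\<integral>\<^sup>+x. (\<integral>\<^sup>+y. of_nat n * indicator A (x, y) * indicator {g x..} y \<partial>lborel) * indicator {0..1} x \<partial>lborel)"
proof -
  have "emeasure \<Lambda> A = (\<integral>\<^sup>+z. indicator A z \<partial>\<Lambda>)"
    using assms by (subst nn_integral_indicator) (auto simp: sets_intensity)
  also have "\<dots> = (\<integral>\<^sup>+x. (\<integral>\<^sup>+y. of_nat n * indicator A (x, y) * indicator {g x..} y \<partial>lborel) * indicator {0..1} x \<partial>lborel)"
    using assms by (intro nn_integral_intensity) auto
  finally show ?thesis .
qed

lemma g_bounds: "x \<in> {0..1} \<Longrightarrow> \<bar>g x\<bar> \<le> \<bar>g 0\<bar> + R"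
  using hoelder_ball_osc[OF g \<beta>(1) R, of x 0] by auto

lemma AE_good_points: "AE \<omega> in M. good_points g (\<lambda>k. Z k \<omega>)"
proof -
  define N where "N = {z \<in> {0..1} \<times> UNIV. snd z < G (fst z)}"
  have "{z \<in> space borel. snd z < G (fst z)} \<in> sets (borel :: (real \<times> real) measure)"
    unfolding borel_prod[symmetric] by measurable
  moreover have "N = ({0..1} \<times> UNIV) \<inter> {z \<in> space borel. snd z < G (fst z)}"
    by (auto simp: N_def)
  ultimately have N: "N \<in> sets borel" "N \<subseteq> {0..1} \<times> UNIV"
    using strip_borel by (auto intro: sets.Int)
  have z: "emeasure \<Lambda> N = 0"
  proof -
    have *: "of_nat n * indicator N (x, y) * indicator {g x..} y = (0::ennreal)" if "x \<in> {0..1}" for x y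
      using that by (auto simp: N_def indicator_def)
    have "(\<integral>\<^sup>+y. of_nat n * indicator N (x, y) * indicator {g x..} y \<partial>lborel) * indicator {0..1} x = (0::ennreal)" for x
    proof (cases "x \<in> {0..1}")
      case True
      have "(\<integral>\<^sup>+y. of_nat n * indicator N (x, y) * indicator {g x..} y \<partial>lborel) = (\<integral>\<^sup>+y. (0::ennreal) \<partial>(lborel :: real measure))"
        by (rule nn_integral_cong) (rule *[OF True])
      then show ?thesis by simp
    qed simp
    then show ?thesis unfolding emeasure_intensity[OF N] by (simp only: nn_integral_const mult_zero_left)
  qed
  have "AE \<omega> in M. point_count Z N \<omega> = 0"
  proof -
    have "prob {\<omega> \<in> space M. point_count Z N \<omega> = of_nat 0} = 1"
      using poisson_count[of N 0] N z by (simp add: sets_intensity measure_def)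
    moreover have [measurable]: "N \<in> sets \<Lambda>" using N by (simp add: sets_intensity)
    ultimately show ?thesis
      by (subst prob_Collect_eq_1[symmetric]) simp_all
  qed
  with AE_space show ?thesis
  proof eventually_elim
    case (elim \<omega>)
    have "Z k \<omega> \<in> {0..1} \<times> UNIV" for k
      using measurable_space[OF measurable_point elim(1)] by (simp add: space_intensity)
    with elim(2) show ?case
      by (fastforce simp: good_points_def point_count_eq_0_iff N_def mem_Times_iff not_less)
  qed
qed

text \<open>At u the vertical section between curve and cone has height y - R|x - u|^\<beta> - g u,
  when this is nonnegative, and the Hoelder bound on g u costs a second R|x - u|^\<beta>. This is
  the origin of the factor 2R.\<close>

lemma emeasure_below_ge:
  assumes x: "x \<in> {0..1}" and y: "g x \<le> y"
  shows "ennreal (real n * rate \<beta> R (y - g x)) \<le> emeasure \<Lambda> (below \<beta> R (x, y))"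
proof -
  have "ennreal (real n * rate \<beta> R (y - g x)) = of_nat n * ennreal (rate \<beta> R (y - g x))"
    using y rate_nonneg[OF \<beta>(1), of "y - g x" R]
    by (simp add: ennreal_mult ennreal_of_nat_eq_real_of_nat)
  also have "\<dots> \<le> of_nat n * (\<integral>\<^sup>+u. ennreal (y - g x - 2 * R * \<bar>x - u\<bar> powr \<beta>) * indicator {0..1} u \<partial>lborel)"
    using x y by (intro mult_left_mono area_ge_rate \<beta> R) auto
  also have "\<dots> = (\<integral>\<^sup>+u. of_nat n * ennreal (y - g x - 2 * R * \<bar>x - u\<bar> powr \<beta>) * indicator {0..1} u \<partial>lborel)"
    by (subst nn_integral_cmult[symmetric]) (auto simp: mult.assoc)
  also have "\<dots> \<le> (\<integral>\<^sup>+u. (\<integral>\<^sup>+v. of_nat n * indicator (below \<beta> R (x, y)) (u, v) * indicator {g u..} v \<partial>lborel)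
      * indicator {0..1} u \<partial>lborel)"
  proof (rule nn_integral_mono)
    fix u
    show "of_nat n * ennreal (y - g x - 2 * R * \<bar>x - u\<bar> powr \<beta>) * indicator {0..1} u \<le>
      (\<integral>\<^sup>+v. of_nat n * indicator (below \<beta> R (x, y)) (u, v) * indicator {g u..} v \<partial>lborel) * indicator {0..1} u"
    proof (cases "u \<in> {0..1}")
      case True
      define c where "c = y - R * \<bar>x - u\<bar> powr \<beta>"
      have "y - g x - 2 * R * \<bar>x - u\<bar> powr \<beta> \<le> c - g u"
        using hoelder_ballD[OF g x True] by (simp add: c_def)
      then have "ennreal (y - g x - 2 * R * \<bar>x - u\<bar> powr \<beta>) \<le> ennreal (c - g u)"
        by (rule ennreal_leI)
      also have "\<dots> \<le> emeasure lborel {g u..<c}"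
        by (cases "g u \<le> c") (auto simp: ennreal_neg)
      finally have "of_nat n * ennreal (y - g x - 2 * R * \<bar>x - u\<bar> powr \<beta>) \<le> of_nat n * emeasure lborel {g u..<c}"
        by (rule mult_left_mono) simp
      also have "\<dots> = (\<integral>\<^sup>+v. of_nat n * indicator {g u..<c} v \<partial>lborel)"
        by (subst nn_integral_cmult_indicator) auto
      also have "\<dots> = (\<integral>\<^sup>+v. of_nat n * indicator (below \<beta> R (x, y)) (u, v) * indicator {g u..} v \<partial>lborel)"
        using True by (intro nn_integral_cong) (auto simp: indicator_def below_def c_def)
      finally show ?thesis using True by simp
    qed simp
  qed
  also have "\<dots> = emeasure \<Lambda> (below \<beta> R (x, y))"
    by (rule emeasure_intensity[symmetric]) (auto simp: below_borel, auto simp: below_def)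
  finally show ?thesis .
qed

lemma below_sets: "below \<beta> R z \<in> sets \<Lambda>"
  using below_borel by (auto simp: sets_intensity below_def)

text \<open>The void probability is exp of minus the intensity of the region. In the infinite case
  \<open>infinite_count\<close> makes the void event null, which spares a proof of
  finiteness.\<close>

lemma expectation_vacant_below_le:
  assumes x: "x \<in> {0..1}" and y: "g x \<le> y"
  shows "expectation (vacant (below \<beta> R (x, y))) \<le> exp (- real n * rate \<beta> R (y - g x))"
proof (cases "emeasure \<Lambda> (below \<beta> R (x, y)) < \<infinity>")
  case True
  let ?A = "below \<beta> R (x, y)"
  have [measurable]: "?A \<in> sets \<Lambda>" by (rule below_sets)
  have "expectation (vacant ?A) = expectation (indicator {\<omega> \<in> space M. point_count Z ?A \<omega> = 0})"
    by (intro Bochner_Integration.integral_cong) (auto simp: vacant_eq indicator_def)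
  also have "\<dots> = prob {\<omega> \<in> space M. point_count Z ?A \<omega> = 0}"
    by (subst Bochner_Integration.integral_indicator) (rule arg_cong[where f=prob], auto)
  also have "\<dots> = exp (- measure \<Lambda> ?A)"
    using poisson_count[OF below_sets True, of 0] by simp
  also have "\<dots> \<le> exp (- real n * rate \<beta> R (y - g x))"
  proof -
    have "emeasure \<Lambda> ?A = ennreal (measure \<Lambda> ?A)"
      using True by (intro emeasure_eq_ennreal_measure) auto
    then show ?thesis
      using emeasure_below_ge[OF x y] by (simp add: ennreal_le_iff)
  qed
  finally show ?thesis .
next
  case False
  then have "AE \<omega> in M. point_count Z (below \<beta> R (x, y)) \<omega> = \<infinity>"
    by (intro infinite_count below_sets) (metis infinity_ennreal_def top.not_eq_extremum)
  then have "expectation (vacant (below \<beta> R (x, y))) = expectation (\<lambda>_. 0)"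
    using vacant_measurable[OF below_sets]
    by (intro integral_cong_AE) (auto simp: vacant_eq elim!: eventually_mono)
  then show ?thesis by simp
qed

text \<open>The part of the strip up to height \<open>T\<close> has finite intensity, hence almost
  surely finitely many points; \<open>G\<close> in place of \<open>g\<close> keeps it Borel.\<close>

definition K :: "real \<Rightarrow> (real \<times> real) set" where
  "K T = {z \<in> {0..1} \<times> UNIV. G (fst z) \<le> snd z \<and> snd z \<le> T}"

lemma K_borel [measurable]: "K T \<in> sets borel"
proof -
  have "{z \<in> space borel. G (fst z) \<le> snd z \<and> snd z \<le> T} \<in> sets (borel :: (real \<times> real) measure)"
    unfolding borel_prod[symmetric] by measurable
  moreover have "K T = ({0..1} \<times> UNIV) \<inter> {z \<in> space borel. G (fst z) \<le> snd z \<and> snd z \<le> T}"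
    by (auto simp: K_def)
  ultimately show ?thesis using sets.Int[OF strip_borel] by (simp only:)
qed

lemma K_sets: "K T \<in> sets \<Lambda>"
  using K_borel by (auto simp: sets_intensity K_def)

lemma K_bounds: "z \<in> K T \<Longrightarrow> fst z \<in> {0..1} \<and> g (fst z) \<le> snd z \<and> snd z \<le> T \<and> \<bar>snd z\<bar> \<le> \<bar>T\<bar> + \<bar>g 0\<bar> + R"
  using g_bounds[of "fst z"] R by (auto simp: K_def)

lemma emeasure_K_lborel: "emeasure lborel (K T) < \<infinity>"
proof -
  have "K T \<subseteq> {0..1} \<times> {- (\<bar>T\<bar> + \<bar>g 0\<bar> + R)..\<bar>T\<bar> + \<bar>g 0\<bar> + R}"
    using K_bounds[of _ T] by (fastforce simp: mem_Times_iff abs_le_iff)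
  then have "bounded (K T)"
    by (rule bounded_subset[rotated]) (intro bounded_Times bounded_closed_interval)
  then show ?thesis by (rule emeasure_bounded_finite)
qed

lemma emeasure_K: "emeasure \<Lambda> (K T) < \<infinity>"
proof -
  have "emeasure \<Lambda> (K T) \<le> (\<integral>\<^sup>+x. (\<integral>\<^sup>+y. of_nat n * indicator (K T) (x, y) \<partial>lborel) \<partial>lborel)"
    unfolding emeasure_intensity[OF K_borel[of T] K_sets[unfolded sets_intensity, THEN conjunct2]]
  proof (rule nn_integral_mono)
    fix x :: real
    have "(\<integral>\<^sup>+y. of_nat n * indicator (K T) (x, y) * indicator {g x..} y \<partial>lborel) * indicator {0..1} x
      \<le> (\<integral>\<^sup>+y. of_nat n * indicator (K T) (x, y) * indicator {g x..} y \<partial>lborel)"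
      by (cases "x \<in> {0..1}") simp_all
    also have "\<dots> \<le> (\<integral>\<^sup>+y. of_nat n * indicator (K T) (x, y) \<partial>lborel)"
      by (rule nn_integral_mono) (simp add: indicator_def)
    finally show "(\<integral>\<^sup>+y. of_nat n * indicator (K T) (x, y) * indicator {g x..} y \<partial>lborel) * indicator {0..1} x
      \<le> (\<integral>\<^sup>+y. of_nat n * indicator (K T) (x, y) \<partial>lborel)" .
  qed
  also have "\<dots> = of_nat n * emeasure lborel (K T)"
    by (subst nn_integral_lborel_prod[symmetric]) (simp_all add: nn_integral_cmult)
  also have "\<dots> < \<infinity>"
    using emeasure_K_lborel[of T] by (simp add: ennreal_mult_less_top of_nat_less_top)
  finally show ?thesis .
qed

lemma set_integral_intensity:
  fixes u :: "real \<times> real \<Rightarrow> real"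
  assumes u [measurable]: "u \<in> borel_measurable borel" and bound: "\<And>z. z \<in> K T \<Longrightarrow> \<bar>u z\<bar> \<le> B"
  shows "(LINT z:K T|\<Lambda>. u z) = real n * (LBINT x:{0..1}. LBINT y:{g x..T}. u (x, y))"
proof -
  have int: "integrable lborel (\<lambda>z. indicator (K T) z *\<^sub>R u z)"
    using bound emeasure_K_lborel[of T] by (intro integrableI_bounded_set_indicator[where B=B]) auto
  have [measurable]: "(\<lambda>z. real n * of_bool (G (fst z) \<le> snd z)) \<in> borel_measurable (borel :: (real \<times> real) measure)"
    unfolding borel_prod[symmetric] by measurable
  have "(LINT z:K T|\<Lambda>. u z) = (\<integral>z. (real n * of_bool (G (fst z) \<le> snd z)) *\<^sub>R (indicator (K T) z *\<^sub>R u z)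
    \<partial>restrict_space lborel ({0..1} \<times> UNIV))"
    unfolding set_lebesgue_integral_def intensity_eq
    by (rule integral_density; (rule measurable_restrict_space1)?) auto
  also have "\<dots> = (\<integral>z. indicator ({0..1} \<times> UNIV) z *\<^sub>R ((real n * of_bool (G (fst z) \<le> snd z)) *\<^sub>R (indicator (K T) z *\<^sub>R u z)) \<partial>lborel)"
    by (rule integral_restrict_space) simp
  also have "\<dots> = (\<integral>z. real n * (indicator (K T) z *\<^sub>R u z) \<partial>lborel)"
    by (intro Bochner_Integration.integral_cong) (auto simp: K_def indicator_def)
  also have "\<dots> = real n * (\<integral>z. indicator (K T) z *\<^sub>R u z \<partial>lborel)"
    by simp
  also have "(\<integral>z. indicator (K T) z *\<^sub>R u z \<partial>lborel) = (\<integral>x. (\<integral>y. indicator (K T) (x, y) *\<^sub>R u (x, y) \<partial>lborel) \<partial>lborel)"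
    using lborel_pair.integral_fst'[of "\<lambda>z. indicator (K T) z *\<^sub>R u z"] int by (simp add: lborel_prod)
  also have "\<dots> = (LBINT x:{0..1}. LBINT y:{g x..T}. u (x, y))"
    unfolding set_lebesgue_integral_def
  proof (intro Bochner_Integration.integral_cong refl)
    fix x :: real
    show "(\<integral>y. indicator (K T) (x, y) *\<^sub>R u (x, y) \<partial>lborel) =
      indicator {0..1} x *\<^sub>R (\<integral>y. indicator {g x..T} y *\<^sub>R u (x, y) \<partial>lborel)"
    proof (cases "x \<in> {0..1}")
      case True
      then have "indicator (K T) (x, y) = (indicator {g x..T} y :: real)" for y
        by (auto simp: K_def indicator_def)
      then show ?thesis using True by simp
    qed (auto simp: K_def)
  qed
  finally show ?thesis .
qed

lemma vacant_below_iff: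
  assumes z: "good_points g z" and x: "x \<in> {0..1}"
  shows "(\<forall>k. z k \<notin> below \<beta> R (x, y)) \<longleftrightarrow> y \<le> mle \<beta> R z x"
proof -
  have "z k \<in> below \<beta> R (x, y) \<longleftrightarrow> \<not> y \<le> snd (z k) + R * \<bar>x - fst (z k)\<bar> powr \<beta>" for k
    using z by (auto simp: good_points_def below_def mem_Times_iff)
  then show ?thesis
    using le_mle_iff[OF \<beta> R g z x] by simp
qed

section \<open>The estimation error as a compensated integral\<close>

lemma set_integrable_hoelder_compose:
  assumes h: "h \<in> hoelder_ball \<beta> R" and \<Phi>: "continuous_on UNIV \<Phi>"
  shows "set_integrable lborel {0..1} (\<lambda>x. \<Phi> (h x) :: real)"
  by (rule borel_integrable_atLeastAtMost', rule continuous_on_compose2[OF \<Phi> hoelder_ball_continuous[OF h \<beta>(1) R]]) auto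

text \<open>In the compensator the y-integral of \<Phi>' runs from g x to h x, where h is the
  estimated curve, so it equals n times the integral of \<Phi>(h x) - \<Phi>(g x); the sum over
  points is the correction term of the estimator. Every \<open>T\<close> allowed here lies above h,
  so the truncation changes nothing.\<close>

lemma estimator_error:
  fixes \<Phi> \<Phi>' :: "real \<Rightarrow> real" and z :: "nat \<Rightarrow> real \<times> real"
  assumes wd: "has_weak_derivative \<Phi> \<Phi>'" and bound: "\<And>y. y \<in> snd ` K T \<Longrightarrow> \<bar>\<Phi>' y\<bar> \<le> B"
    and z: "good_points g z" and T: "snd (z 0) + R \<le> T" and fin: "finite {j. z j \<in> K T}"
  defines "v \<equiv> \<lambda>w. of_bool (\<forall>k. z k \<notin> below \<beta> R w) :: real"
  shows "estimator \<beta> R \<Phi> \<Phi>' n z - functional \<Phi> g =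
    - (1 / real n) * ((\<Sum>j | z j \<in> K T. \<Phi>' (snd (z j)) * v (z j)) - (LINT w:K T|\<Lambda>. \<Phi>' (snd w) * v w))"
proof -
  define h where "h = mle \<beta> R z"
  have h: "h \<in> hoelder_ball \<beta> R" unfolding h_def by (rule mle_hoelder[OF \<beta> R g z])
  define H where "H x = h (clamp01 x)" for x
  have [measurable]: "H \<in> borel_measurable borel" "\<Phi>' \<in> borel_measurable borel"
    using hoelder_ball_clamp_measurable[OF h \<beta>(1) R] weak_derivative_measurable[OF wd]
    by (simp_all add: H_def[abs_def])
  have H_eq: "H x = h x" if "x \<in> {0..1}" for x using that by (simp add: H_def)
  have v_eq: "v w = of_bool (snd w \<le> h (fst w))" if "fst w \<in> {0..1}" for w
    using vacant_below_iff[OF z that, of "snd w"] by (simp add: v_def h_def)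
  have h_le: "h x \<le> T" "g x \<le> h x" if "x \<in> {0..1}" for x
    using mle_bounded[OF \<beta> R g z that] le_mle[OF \<beta> R g z that] T by (simp_all add: h_def)
  have zx: "fst (z j) \<in> {0..1}" for j using z by (simp add: good_points_def)
  \<comment> \<open>A point outside \<open>K T\<close> lies above \<open>T\<close>, hence above the
    estimated curve, and contributes zero.\<close>
  have "(\<Sum>j. \<Phi>' (snd (z j)) * of_bool (h (fst (z j)) \<ge> snd (z j))) =
    (\<Sum>j | z j \<in> K T. \<Phi>' (snd (z j)) * of_bool (h (fst (z j)) \<ge> snd (z j)))"
  proof (rule suminf_finite[OF fin])
    fix j assume "j \<notin> {j. z j \<in> K T}"
    moreover have "g (fst (z j)) \<le> snd (z j)" using z by (simp add: good_points_def)
    ultimately have "T < snd (z j)"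
      using zx[of j] by (auto simp: K_def mem_Times_iff not_le)
    then show "\<Phi>' (snd (z j)) * of_bool (h (fst (z j)) \<ge> snd (z j)) = 0"
      using h_le(1)[OF zx[of j]] by simp
  qed
  also have "\<dots> = (\<Sum>j | z j \<in> K T. \<Phi>' (snd (z j)) * v (z j))"
    using v_eq[OF zx] by (intro sum.cong) simp_all
  finally have 1: "(\<Sum>j. \<Phi>' (snd (z j)) * of_bool (h (fst (z j)) \<ge> snd (z j))) = \<dots>" .
  have "(LINT w:K T|\<Lambda>. \<Phi>' (snd w) * v w) = (LINT w:K T|\<Lambda>. \<Phi>' (snd w) * of_bool (snd w \<le> H (fst w)))"
    unfolding set_lebesgue_integral_def
    using v_eq by (intro Bochner_Integration.integral_cong refl) (auto simp: K_def indicator_def H_eq)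
  also have "\<dots> = real n * (LBINT x:{0..1}. LBINT y:{g x..T}. \<Phi>' y * of_bool (y \<le> H x))"
  proof (subst set_integral_intensity[where B=B])
    show "(\<lambda>w. \<Phi>' (snd w) * of_bool (snd w \<le> H (fst w))) \<in> borel_measurable borel"
      unfolding borel_prod[symmetric] by measurable
    fix w assume "w \<in> K T"
    then have "\<bar>\<Phi>' (snd w)\<bar> \<le> B" by (intro bound) auto
    then show "\<bar>\<Phi>' (snd w) * of_bool (snd w \<le> H (fst w))\<bar> \<le> B" by auto
  qed simp
  also have "(LBINT x:{0..1}. LBINT y:{g x..T}. \<Phi>' y * of_bool (y \<le> H x)) = (LBINT x:{0..1}. \<Phi> (h x) - \<Phi> (g x))"
  proof (rule set_lebesgue_integral_cong)
    show "\<forall>x. x \<in> {0..1} \<longrightarrow> (LBINT y:{g x..T}. \<Phi>' y * of_bool (y \<le> H x)) = \<Phi> (h x) - \<Phi> (g x)"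
    proof (intro allI impI)
      fix x :: real assume x: "x \<in> {0..1}"
      have "(LBINT y:{g x..T}. \<Phi>' y * of_bool (y \<le> H x)) = (LBINT y:{g x..h x}. \<Phi>' y)"
        unfolding set_lebesgue_integral_def
        using h_le[OF x] by (intro Bochner_Integration.integral_cong refl) (auto simp: indicator_def H_eq[OF x])
      then show "(LBINT y:{g x..T}. \<Phi>' y * of_bool (y \<le> H x)) = \<Phi> (h x) - \<Phi> (g x)"
        using weak_derivative_diff[OF wd h_le(2)[OF x]] by simp
    qed
  qed simp
  also have "\<dots> = (LBINT x:{0..1}. \<Phi> (h x)) - functional \<Phi> g"
    unfolding functional_def
    by (intro set_integral_diff set_integrable_hoelder_compose h g weak_derivative_continuous[OF wd])
  finally have 2: "(LINT w:K T|\<Lambda>. \<Phi>' (snd w) * v w) = real n * ((LBINT x:{0..1}. \<Phi> (h x)) - functional \<Phi> g)" .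
  have "estimator \<beta> R \<Phi> \<Phi>' n z = (LBINT x:{0..1}. \<Phi> (h x)) -
      1 / real n * (\<Sum>j | z j \<in> K T. \<Phi>' (snd (z j)) * v (z j))"
    using 1 by (simp add: estimator_def h_def)
  then show ?thesis using 2 n by (simp add: field_simps)
qed

text \<open>Cells arise by rounding x, y and the value \<Phi>' y down to multiples of 1/s. The third
  coordinate is there because \<Phi>' is merely measurable: small cells in the plane would not make
  it nearly constant.\<close>

lemma compensated_estimator_moment:
  fixes \<Phi>' :: "real \<Rightarrow> real"
  assumes [measurable]: "\<Phi>' \<in> borel_measurable borel" and bound: "\<And>y. y \<in> snd ` K T \<Longrightarrow> \<bar>\<Phi>' y\<bar> \<le> B"
  obtains J where "J \<in> borel_measurable M"
    and "AE \<omega> in M. J \<omega> = (\<Sum>j | Z j \<omega> \<in> K T. \<Phi>' (snd (Z j \<omega>)) * vacant (below \<beta> R (Z j \<omega>)) \<omega>) -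
      (LINT z:K T|\<Lambda>. \<Phi>' (snd z) * vacant (below \<beta> R z) \<omega>)"
    and "(\<integral>\<^sup>+\<omega>. ennreal ((J \<omega>)\<^sup>2) \<partial>M) \<le>
      (\<integral>\<^sup>+z. ennreal ((\<Phi>' (snd z))\<^sup>2 * exp (- real n * rate \<beta> R (snd z - G (fst z)))) \<partial>\<Lambda>)"
proof -
  define s where "s m = real (Suc m)" for m
  have s_pos: "0 < s m" for m by (simp add: s_def)
  define key where "key m z = (\<lfloor>s m * fst z\<rfloor>, \<lfloor>s m * snd z\<rfloor>, \<lfloor>s m * \<Phi>' (snd z)\<rfloor>)" for m and z :: "real \<times> real"
  \<comment> \<open>The apex is the rounded point, lowered by R (1/s)^\<beta> to absorb the
    horizontal rounding; rounding the height down already errs on the safe side. Thus the region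
    lies inside that of every point of the cell.\<close>
  define Dm where "Dm m i = below \<beta> R (of_int (fst i) / s m, of_int (fst (snd i)) / s m - R * (1 / s m) powr \<beta>)"
    for m and i :: "int \<times> int \<times> int"
  define a where "a m i = of_int (snd (snd i)) / s m" for m and i :: "int \<times> int \<times> int"
  have floor_approx: "u - 1 / s m \<le> of_int \<lfloor>s m * u\<rfloor> / s m" "of_int \<lfloor>s m * u\<rfloor> / s m \<le> u" for m u
  proof -
    have "(s m * u - 1) / s m \<le> of_int \<lfloor>s m * u\<rfloor> / s m" "of_int \<lfloor>s m * u\<rfloor> / s m \<le> s m * u / s m"
      using s_pos[of m] by (intro divide_right_mono; linarith)+
    then show "u - 1 / s m \<le> of_int \<lfloor>s m * u\<rfloor> / s m" "of_int \<lfloor>s m * u\<rfloor> / s m \<le> u"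
      using s_pos[of m] by (simp_all add: diff_divide_distrib)
  qed
  have s_inv: "(\<lambda>m. 1 / s m) \<longlonglongrightarrow> 0"
    unfolding s_def using LIMSEQ_inverse_real_of_nat by (simp add: inverse_eq_divide)
  have s_inv_powr: "(\<lambda>m. (1 / s m) powr \<beta>) \<longlonglongrightarrow> 0"
    using \<beta>(1) s_pos by (intro tendsto_zero_powrI[OF s_inv tendsto_const]) (auto intro!: always_eventually less_imp_le)
  show ?thesis
  proof (rule compensated_integral_second_moment_le[of "K T" key Dm "below \<beta> R" a "\<lambda>z. \<Phi>' (snd z)" "B + 1"])
    show "K T \<in> sets \<Lambda>" "emeasure \<Lambda> (K T) < \<infinity>" by (rule K_sets emeasure_K)+
    show "finite (key m ` K T)" for m
    proof (rule finite_subset)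
      define b where "b = \<bar>T\<bar> + \<bar>g 0\<bar> + R"
      show "key m ` K T \<subseteq> {\<lfloor>s m * 0\<rfloor>..\<lfloor>s m * 1\<rfloor>} \<times> {\<lfloor>s m * (- b)\<rfloor>..\<lfloor>s m * b\<rfloor>} \<times> {\<lfloor>s m * (- B)\<rfloor>..\<lfloor>s m * B\<rfloor>}"
      proof (rule image_subsetI)
        fix z assume z: "z \<in> K T"
        have mono: "\<lfloor>s m * u\<rfloor> \<in> {\<lfloor>s m * lo\<rfloor>..\<lfloor>s m * hi\<rfloor>}" if "lo \<le> u" "u \<le> hi" for u lo hi
          using that s_pos[of m] unfolding atLeastAtMost_iff by (intro conjI floor_mono mult_left_mono) auto
        have "\<bar>\<Phi>' (snd z)\<bar> \<le> B" using z by (intro bound) auto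
        then show "key m z \<in> {\<lfloor>s m * 0\<rfloor>..\<lfloor>s m * 1\<rfloor>} \<times> {\<lfloor>s m * (- b)\<rfloor>..\<lfloor>s m * b\<rfloor>} \<times> {\<lfloor>s m * (- B)\<rfloor>..\<lfloor>s m * B\<rfloor>}"
          using K_bounds[OF z] unfolding key_def b_def[symmetric]
          by (intro SigmaI mono) (auto simp: abs_le_iff)
      qed
    qed simp
    show "{z \<in> K T. key m z = i} \<in> sets \<Lambda>" for m i
    proof -
      have "{z \<in> space borel. \<lfloor>s m * fst z\<rfloor> = fst i \<and> \<lfloor>s m * snd z\<rfloor> = fst (snd i) \<and>
          \<lfloor>s m * \<Phi>' (snd z)\<rfloor> = snd (snd i)} \<in> sets (borel :: (real \<times> real) measure)"
        unfolding borel_prod[symmetric] by measurable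
      moreover have "{z \<in> K T. key m z = i} = K T \<inter> {z \<in> space borel. \<lfloor>s m * fst z\<rfloor> = fst i \<and>
          \<lfloor>s m * snd z\<rfloor> = fst (snd i) \<and> \<lfloor>s m * \<Phi>' (snd z)\<rfloor> = snd (snd i)}"
        by (auto simp: key_def)
      ultimately show ?thesis using K_borel by (auto simp: sets_intensity K_def)
    qed
    show "Dm m i \<in> sets \<Lambda>" for m i unfolding Dm_def by (rule below_sets)
    show "z \<notin> below \<beta> R w" if "w \<in> K T" "z \<in> K T" "w \<in> below \<beta> R z" for w z
    proof -
      have "0 \<le> R * \<bar>fst z - fst w\<bar> powr \<beta>" "0 \<le> R * \<bar>fst w - fst z\<bar> powr \<beta>" using R by auto
      with that(3) show ?thesis by (auto simp: below_def)
    qed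
    show "w \<in> below \<beta> R z" if z: "z \<in> K T" and w: "w \<in> Dm m (key m z)" for m w z
    proof -
      define x where "x = of_int \<lfloor>s m * fst z\<rfloor> / s m"
      have "\<bar>fst z - x\<bar> \<le> 1 / s m" using floor_approx(1)[of "fst z" m] floor_approx(2)[of m "fst z"] by (simp add: x_def)
      then have "\<bar>fst z - x\<bar> powr \<beta> \<le> (1 / s m) powr \<beta>" using \<beta> by (intro powr_mono2) auto
      then have "\<bar>fst z - fst w\<bar> powr \<beta> \<le> (1 / s m) powr \<beta> + \<bar>x - fst w\<bar> powr \<beta>"
        using abs_diff_powr_triangle[OF \<beta>, of "fst z" "fst w" x] by simp
      then have "R * \<bar>fst z - fst w\<bar> powr \<beta> \<le> R * (1 / s m) powr \<beta> + R * \<bar>x - fst w\<bar> powr \<beta>"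
        using R by (metis distrib_left less_imp_le mult_left_mono)
      then show ?thesis
        using w floor_approx(2)[of m "snd z"]
        by (auto simp: Dm_def key_def below_def x_def)
    qed
    show "\<forall>\<^sub>F m in sequentially. w \<in> Dm m (key m z)" if z: "z \<in> K T" and w: "w \<in> space \<Lambda>" "w \<in> below \<beta> R z" for w z
    proof -
      define \<epsilon> where "\<epsilon> = snd z - (snd w + R * \<bar>fst z - fst w\<bar> powr \<beta>)"
      have "0 < \<epsilon>" using w by (simp add: \<epsilon>_def below_def)
      \<comment> \<open>One R (1/s)^\<beta> is the deliberate lowering of the apex, the other the
        horizontal rounding error, and 1/s the vertical one. Strict membership leaves the margin
        \<open>\<epsilon>\<close> to cover them.\<close>
      moreover have "(\<lambda>m. 2 * R * (1 / s m) powr \<beta> + 1 / s m) \<longlonglongrightarrow> 2 * R * 0 + 0"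
        by (intro tendsto_intros s_inv s_inv_powr)
      ultimately have "\<forall>\<^sub>F m in sequentially. 2 * R * (1 / s m) powr \<beta> + 1 / s m < \<epsilon>"
        by (intro order_tendstoD) auto
      then show ?thesis
      proof eventually_elim
        case (elim m)
        define x where "x = of_int \<lfloor>s m * fst z\<rfloor> / s m"
        have "\<bar>x - fst z\<bar> \<le> 1 / s m" using floor_approx(1)[of "fst z" m] floor_approx(2)[of m "fst z"] by (simp add: x_def)
        then have "\<bar>x - fst z\<bar> powr \<beta> \<le> (1 / s m) powr \<beta>" using \<beta> by (intro powr_mono2) auto
        then have "\<bar>x - fst w\<bar> powr \<beta> \<le> (1 / s m) powr \<beta> + \<bar>fst z - fst w\<bar> powr \<beta>"
          using abs_diff_powr_triangle[OF \<beta>, of x "fst w" "fst z"] by simp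
        then have "R * \<bar>x - fst w\<bar> powr \<beta> \<le> R * (1 / s m) powr \<beta> + R * \<bar>fst z - fst w\<bar> powr \<beta>"
          using R by (metis distrib_left less_imp_le mult_left_mono)
        then have "snd w + R * \<bar>x - fst w\<bar> powr \<beta> < of_int \<lfloor>s m * snd z\<rfloor> / s m - R * (1 / s m) powr \<beta>"
          using elim floor_approx(1)[of "snd z" m] unfolding \<epsilon>_def by linarith
        then show ?case
          using w(2) by (simp add: Dm_def key_def below_def x_def)
      qed
    qed
    show "(\<lambda>m. a m (key m z)) \<longlonglongrightarrow> \<Phi>' (snd z)" for z
    proof (rule tendsto_sandwich)
      show "(\<lambda>m. \<Phi>' (snd z) - 1 / s m) \<longlonglongrightarrow> \<Phi>' (snd z)"
        using tendsto_diff[OF tendsto_const s_inv, of "\<Phi>' (snd z)"] by simp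
    qed (use floor_approx in \<open>auto simp: a_def key_def\<close>)
    show "\<bar>a m (key m z)\<bar> \<le> B + 1" if "z \<in> K T" for m z
    proof -
      have "\<bar>\<Phi>' (snd z)\<bar> \<le> B" using that by (intro bound) auto
      moreover have "1 / s m \<le> 1" by (simp add: s_def)
      ultimately show ?thesis
        using floor_approx(1)[of "\<Phi>' (snd z)" m] floor_approx(2)[of m "\<Phi>' (snd z)"] by (simp add: a_def key_def)
    qed
  next
    fix J assume J: "J \<in> borel_measurable M"
      "AE \<omega> in M. J \<omega> = (\<Sum>j | Z j \<omega> \<in> K T. \<Phi>' (snd (Z j \<omega>)) * vacant (below \<beta> R (Z j \<omega>)) \<omega>) -
        (LINT z:K T|\<Lambda>. \<Phi>' (snd z) * vacant (below \<beta> R z) \<omega>)"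
      "(\<integral>\<^sup>+\<omega>. ennreal ((J \<omega>)\<^sup>2) \<partial>M) \<le>
        (\<integral>\<^sup>+z. ennreal ((\<Phi>' (snd z))\<^sup>2 * expectation (vacant (below \<beta> R z))) * indicator (K T) z \<partial>\<Lambda>)"
    note J(3)
    also have "(\<integral>\<^sup>+z. ennreal ((\<Phi>' (snd z))\<^sup>2 * expectation (vacant (below \<beta> R z))) * indicator (K T) z \<partial>\<Lambda>) \<le>
      (\<integral>\<^sup>+z. ennreal ((\<Phi>' (snd z))\<^sup>2 * exp (- real n * rate \<beta> R (snd z - G (fst z)))) \<partial>\<Lambda>)"
    proof (rule nn_integral_mono)
      fix z
      show "ennreal ((\<Phi>' (snd z))\<^sup>2 * expectation (vacant (below \<beta> R z))) * indicator (K T) z \<le>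
        ennreal ((\<Phi>' (snd z))\<^sup>2 * exp (- real n * rate \<beta> R (snd z - G (fst z))))"
      proof (cases "z \<in> K T")
        case True
        have "expectation (vacant (below \<beta> R z)) \<le> exp (- real n * rate \<beta> R (snd z - G (fst z)))"
          using expectation_vacant_below_le[of "fst z" "snd z"] K_bounds[OF True] by simp
        then show ?thesis using True by (simp add: ennreal_leI mult_left_mono)
      qed simp
    qed
    finally show ?thesis using that J(1,2) by blast
  qed
qed

text \<open>The height at which \<open>estimator_error\<close> applies depends on the realisation,
  so no fixed \<open>T\<close> serves. Along T = m the compensated integrals, scaled by -1/n, almost
  surely equal the error from some m on, while their second moments have a bound free of m; Fatou's
  lemma transfers it to the limit.\<close>

theorem mean_squared_error_le:
  fixes \<Phi> \<Phi>' :: "real \<Rightarrow> real"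
  assumes wd: "has_weak_derivative \<Phi> \<Phi>'" and C: "0 < C" and growth: "\<And>u. \<bar>\<Phi>' u\<bar> \<le> C * exp (C * \<bar>u\<bar>)"
  shows "mean_squared_error M Z (estimator \<beta> R \<Phi> \<Phi>' n) (functional \<Phi> g) \<le>
    ennreal (1 / real n) * (\<integral>\<^sup>+t. ennreal (exp (- real n * rate \<beta> R t)) *
      (\<integral>\<^sup>+x. ennreal ((\<Phi>' (g x + t))\<^sup>2) * indicator {0..1} x \<partial>lborel) * indicator {0..} t \<partial>lborel)"
proof -
  have [measurable]: "\<Phi>' \<in> borel_measurable borel" by (rule weak_derivative_measurable[OF wd])
  define B where "B T = C * exp (C * (\<bar>T\<bar> + \<bar>g 0\<bar> + R))" for T
  have bound: "\<bar>\<Phi>' y\<bar> \<le> B T" if "y \<in> snd ` K T" for y T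
  proof -
    have "\<bar>y\<bar> \<le> \<bar>T\<bar> + \<bar>g 0\<bar> + R" using that K_bounds by blast
    then have "C * exp (C * \<bar>y\<bar>) \<le> B T" using C by (simp add: B_def)
    then show ?thesis using growth[of y] by simp
  qed
  define F where "F z = ennreal ((\<Phi>' (snd z))\<^sup>2 * exp (- real n * rate \<beta> R (snd z - G (fst z))))" for z
  have F_meas: "F \<in> borel_measurable borel"
    unfolding F_def borel_prod[symmetric] by measurable
  define E where "E T \<omega> = (\<Sum>j | Z j \<omega> \<in> K T. \<Phi>' (snd (Z j \<omega>)) * vacant (below \<beta> R (Z j \<omega>)) \<omega>) -
      (LINT z:K T|\<Lambda>. \<Phi>' (snd z) * vacant (below \<beta> R z) \<omega>)" for T \<omega>
  have "\<exists>J. J \<in> borel_measurable M \<and> (AE \<omega> in M. J \<omega> = E T \<omega>) \<and>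
      (\<integral>\<^sup>+\<omega>. ennreal ((J \<omega>)\<^sup>2) \<partial>M) \<le> (\<integral>\<^sup>+z. F z \<partial>\<Lambda>)" for T
    unfolding E_def F_def by (rule compensated_estimator_moment[of \<Phi>' T "B T"]) (use bound in auto)
  then obtain J where J: "\<And>T. J T \<in> borel_measurable M" "\<And>T. AE \<omega> in M. J T \<omega> = E T \<omega>"
    "\<And>T. (\<integral>\<^sup>+\<omega>. ennreal ((J T \<omega>)\<^sup>2) \<partial>M) \<le> (\<integral>\<^sup>+z. F z \<partial>\<Lambda>)" by metis
  note [measurable] = J(1)
  define err where "err \<omega> = estimator \<beta> R \<Phi> \<Phi>' n (\<lambda>j. Z j \<omega>) - functional \<Phi> g" for \<omega>
  have "AE \<omega> in M. \<forall>m::nat. J (real m) \<omega> = E (real m) \<omega>"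
    using J(2) by (subst AE_all_countable) auto
  moreover have "AE \<omega> in M. \<forall>m::nat. point_count Z (K (real m)) \<omega> < \<infinity>"
    using AE_point_count_finite[OF K_sets emeasure_K] by (subst AE_all_countable) auto
  ultimately have err_lim: "AE \<omega> in M. (\<lambda>m. ennreal ((1 / real n)\<^sup>2) * ennreal ((J (real m) \<omega>)\<^sup>2)) \<longlonglongrightarrow> ennreal ((err \<omega>)\<^sup>2)"
    using AE_good_points
  proof eventually_elim
    case (elim \<omega>)
    obtain m0 :: nat where m0: "snd (Z 0 \<omega>) + R \<le> real m0" using real_arch_simple by blast
    have "ennreal ((1 / real n)\<^sup>2) * ennreal ((J (real m) \<omega>)\<^sup>2) = ennreal ((err \<omega>)\<^sup>2)" if "m0 \<le> m" for m
    proof -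
      have "err \<omega> = - (1 / real n) * E (real m) \<omega>"
        unfolding err_def E_def vacant_def
        by (rule estimator_error[OF wd bound elim(3)]) (use m0 that num_finite_points(1) elim(2) in auto)
      then show ?thesis using elim(1) by (simp add: power_divide power_mult_distrib flip: ennreal_mult')
    qed
    then show ?case by (intro tendsto_eventually eventually_sequentiallyI)
  qed
  have "mean_squared_error M Z (estimator \<beta> R \<Phi> \<Phi>' n) (functional \<Phi> g) = (\<integral>\<^sup>+\<omega>. ennreal ((err \<omega>)\<^sup>2) \<partial>M)"
    by (simp add: mean_squared_error_def err_def)
  also have "\<dots> \<le> (\<integral>\<^sup>+\<omega>. liminf (\<lambda>m. ennreal ((1 / real n)\<^sup>2) * ennreal ((J (real m) \<omega>)\<^sup>2)) \<partial>M)"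
  \<comment> \<open>\<open>err\<close> is not shown to be measurable; comparison with a measurable
    limes inferior does not require it.\<close>
  proof (rule nn_integral_mono_AE)
    show "AE \<omega> in M. ennreal ((err \<omega>)\<^sup>2) \<le> liminf (\<lambda>m. ennreal ((1 / real n)\<^sup>2) * ennreal ((J (real m) \<omega>)\<^sup>2))"
      using err_lim
    proof eventually_elim
      case (elim \<omega>)
      have "liminf (\<lambda>m. ennreal ((1 / real n)\<^sup>2) * ennreal ((J (real m) \<omega>)\<^sup>2)) = ennreal ((err \<omega>)\<^sup>2)"
        by (rule lim_imp_Liminf[OF _ elim]) simp
      then show ?case by simp
    qed
  qed
  also have "\<dots> \<le> liminf (\<lambda>m. \<integral>\<^sup>+\<omega>. ennreal ((1 / real n)\<^sup>2) * ennreal ((J (real m) \<omega>)\<^sup>2) \<partial>M)"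
    by (rule nn_integral_liminf) measurable
  also have "\<dots> \<le> limsup (\<lambda>m. \<integral>\<^sup>+\<omega>. ennreal ((1 / real n)\<^sup>2) * ennreal ((J (real m) \<omega>)\<^sup>2) \<partial>M)"
    by (rule Liminf_le_Limsup) simp
  also have "\<dots> \<le> ennreal ((1 / real n)\<^sup>2) * (\<integral>\<^sup>+z. F z \<partial>\<Lambda>)"
    by (intro Limsup_bounded always_eventually allI)
       (subst nn_integral_cmult, simp, intro mult_left_mono J(3), simp)
  also have "(\<integral>\<^sup>+z. F z \<partial>\<Lambda>) = of_nat n * (\<integral>\<^sup>+t. ennreal (exp (- real n * rate \<beta> R t)) *
      (\<integral>\<^sup>+x. ennreal ((\<Phi>' (g x + t))\<^sup>2) * indicator {0..1} x \<partial>lborel) * indicator {0..} t \<partial>lborel)"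
  proof -
    \<comment> \<open>The substitution y = g x + t makes the rate a function of t alone, so Fubini
      isolates the x-integral of the squared derivative. The factor n of the intensity will cancel
      one of the two factors 1/n.\<close>
    let ?H = "\<lambda>x t. of_nat n * (ennreal (exp (- real n * rate \<beta> R t)) *
        (ennreal ((\<Phi>' (G x + t))\<^sup>2) * indicator {0..1} x) * indicator {0..} t)"
    have "(\<integral>\<^sup>+y. of_nat n * F (x, y) * indicator {g x..} y \<partial>lborel) * indicator {0..1} x = (\<integral>\<^sup>+t. ?H x t \<partial>lborel)" for x
    proof (cases "x \<in> {0..1}")
      case True
      have [measurable]: "(\<lambda>y. F (x, y)) \<in> borel_measurable borel" unfolding F_def fst_conv snd_conv by measurable
      have "(\<integral>\<^sup>+y. of_nat n * F (x, y) * indicator {g x..} y \<partial>lborel) =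
        ennreal \<bar>1\<bar> * (\<integral>\<^sup>+t. of_nat n * F (x, g x + 1 * t) * indicator {g x..} (g x + 1 * t) \<partial>lborel)"
        by (rule nn_integral_real_affine) measurable
      also have "\<dots> = (\<integral>\<^sup>+t. of_nat n * F (x, g x + 1 * t) * indicator {g x..} (g x + 1 * t) \<partial>lborel)"
        by simp
      also have "\<dots> = (\<integral>\<^sup>+t. ?H x t \<partial>lborel)"
        using True by (intro nn_integral_cong) (simp add: F_def indicator_def ennreal_mult' mult_ac)
      finally show ?thesis using True by simp
    qed simp
    then have "(\<integral>\<^sup>+z. F z \<partial>\<Lambda>) = (\<integral>\<^sup>+x. \<integral>\<^sup>+t. ?H x t \<partial>lborel \<partial>lborel)"
      by (simp only: nn_integral_intensity[OF F_meas])
    also have "\<dots> = (\<integral>\<^sup>+t. \<integral>\<^sup>+x. ?H x t \<partial>lborel \<partial>lborel)"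
      by (rule lborel_pair.Fubini') measurable
    also have "\<dots> = (\<integral>\<^sup>+t. of_nat n * (ennreal (exp (- real n * rate \<beta> R t)) *
      (\<integral>\<^sup>+x. ennreal ((\<Phi>' (g x + t))\<^sup>2) * indicator {0..1} x \<partial>lborel) * indicator {0..} t) \<partial>lborel)"
    proof (rule nn_integral_cong)
      fix t
      have eq: "(\<integral>\<^sup>+x. ennreal ((\<Phi>' (g x + t))\<^sup>2) * indicator {0..1} x \<partial>lborel) =
        (\<integral>\<^sup>+x. ennreal ((\<Phi>' (G x + t))\<^sup>2) * indicator {0..1} x \<partial>lborel)"
        by (intro nn_integral_cong) (simp add: indicator_def)
      show "(\<integral>\<^sup>+x. ?H x t \<partial>lborel) = of_nat n * (ennreal (exp (- real n * rate \<beta> R t)) *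
        (\<integral>\<^sup>+x. ennreal ((\<Phi>' (g x + t))\<^sup>2) * indicator {0..1} x \<partial>lborel) * indicator {0..} t)"
        unfolding eq by (simp add: nn_integral_cmult nn_integral_multc)
    qed
    also have "\<dots> = of_nat n * (\<integral>\<^sup>+t. ennreal (exp (- real n * rate \<beta> R t)) *
      (\<integral>\<^sup>+x. ennreal ((\<Phi>' (g x + t))\<^sup>2) * indicator {0..1} x \<partial>lborel) * indicator {0..} t \<partial>lborel)"
    proof (rule nn_integral_cmult)
      have "(\<lambda>t. ennreal (exp (- real n * rate \<beta> R t)) *
        (\<integral>\<^sup>+x. ennreal ((\<Phi>' (G x + t))\<^sup>2) * indicator {0..1} x \<partial>lborel) * indicator {0..} t) \<in> borel_measurable lborel"
        by measurable
      moreover have "(\<integral>\<^sup>+x. ennreal ((\<Phi>' (g x + t))\<^sup>2) * indicator {0..1} x \<partial>lborel) =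
        (\<integral>\<^sup>+x. ennreal ((\<Phi>' (G x + t))\<^sup>2) * indicator {0..1} x \<partial>lborel)" for t
        by (intro nn_integral_cong) (simp add: indicator_def)
      ultimately show "(\<lambda>t. ennreal (exp (- real n * rate \<beta> R t)) *
        (\<integral>\<^sup>+x. ennreal ((\<Phi>' (g x + t))\<^sup>2) * indicator {0..1} x \<partial>lborel) * indicator {0..} t) \<in> borel_measurable lborel"
        by simp
    qed
    finally show ?thesis .
  qed
  finally show ?thesis
  proof (rule order_trans[OF _ eq_refl])
    have "ennreal ((1 / real n)\<^sup>2) * of_nat n = ennreal (1 / real n)"
      using n by (simp add: ennreal_of_nat_eq_real_of_nat power2_eq_square flip: ennreal_mult')
    then show "ennreal ((1 / real n)\<^sup>2) * (of_nat n * X) = ennreal (1 / real n) * X" for X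
      by (metis mult.assoc)
  qed
qed

end

section \<open>Asymptotics over shrinking neighbourhoods\<close>

text \<open>Provides existence of the limit in the theorem, where the supremum runs over
  neighbourhoods that grow with \<delta>.\<close>

lemma tendsto_at_right_INF:
  fixes f :: "real \<Rightarrow> 'a :: {complete_linorder, linorder_topology}"
  assumes mono: "\<And>x y. 0 < x \<Longrightarrow> x \<le> y \<Longrightarrow> f x \<le> f y"
  shows "(f \<longlongrightarrow> (INF x\<in>{0<..}. f x)) (at_right 0)"
proof (rule order_tendstoI)
  fix a assume a: "a < (INF x\<in>{0<..}. f x)"
  have "\<forall>\<^sub>F x in at_right (0::real). x \<in> {0<..}" by (simp add: eventually_at_right_less)
  then show "\<forall>\<^sub>F x in at_right 0. a < f x"
    by eventually_elim (use a in \<open>auto intro: less_le_trans INF_lower\<close>)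
next
  fix a assume "(INF x\<in>{0<..}. f x) < a"
  then obtain y where y: "0 < y" "f y < a" by (auto simp: INF_less_iff)
  show "\<forall>\<^sub>F x in at_right 0. f x < a"
    using eventually_at_right_less[of 0] eventually_at_right_real[OF y(1)]
  proof eventually_elim
    case (elim x)
    then show ?case using mono[of x y] y(2) by (simp add: le_less_trans)
  qed
qed

section \<open>Squared L2 norms\<close>

lemma set_integrable_bounded_clamp:
  fixes h :: "real \<Rightarrow> real"
  assumes h: "(\<lambda>x. h (clamp01 x)) \<in> borel_measurable borel" and bound: "\<And>x. x \<in> {0..1} \<Longrightarrow> \<bar>h x\<bar> \<le> B"
  shows "set_integrable lborel {0..1} h"
proof -
  have "integrable lborel (\<lambda>x. indicator {0..1} x *\<^sub>R h (clamp01 x))"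
    using h bound by (intro integrableI_bounded_set_indicator[where B=B]) auto
  also have "(\<lambda>x. indicator {0..1} x *\<^sub>R h (clamp01 x)) = (\<lambda>x. indicator {0..1} x *\<^sub>R h x)"
    by (auto simp: indicator_def)
  finally show ?thesis by (simp add: set_integrable_def)
qed

lemma norm_L2_power2: "(norm_L2 h)\<^sup>2 = (LBINT x:{0..1}. (h x)\<^sup>2)"
  unfolding norm_L2_def set_lebesgue_integral_def
  by (intro real_sqrt_pow2 Bochner_Integration.integral_nonneg) auto

lemma nn_integral_power2_eq_norm_L2:
  assumes "set_integrable lborel {0..1} (\<lambda>x. (h x)\<^sup>2)"
  shows "(\<integral>\<^sup>+x. ennreal ((h x)\<^sup>2) * indicator {0..1} x \<partial>lborel) = ennreal ((norm_L2 h)\<^sup>2)"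
proof -
  have "(\<integral>\<^sup>+x. ennreal ((h x)\<^sup>2) * indicator {0..1} x \<partial>lborel) = (\<integral>\<^sup>+x. ennreal (indicator {0..1} x *\<^sub>R (h x)\<^sup>2) \<partial>lborel)"
    by (intro nn_integral_cong) (simp add: indicator_def)
  also have "\<dots> = ennreal (LBINT x:{0..1}. (h x)\<^sup>2)"
    using assms unfolding set_integrable_def set_lebesgue_integral_def
    by (intro nn_integral_eq_integral) auto
  finally show ?thesis by (simp add: norm_L2_power2)
qed

text \<open>Young's inequality 2ab \<le> k a^2 + b^2/k. The free weight keeps the factor of the main
  term at 1 + k, which can be made arbitrarily close to 1; a fixed weight would spoil the leading
  constant.\<close>

lemma power2_add_le_weighted:
  fixes a b k :: real
  assumes "0 < k"
  shows "(a + b)\<^sup>2 \<le> (1 + k) * a\<^sup>2 + (1 + 1 / k) * b\<^sup>2"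
proof -
  have "0 \<le> (k * a - b)\<^sup>2 / k" using assms by simp
  also have "(k * a - b)\<^sup>2 / k = k * a\<^sup>2 - 2 * a * b + 1 / k * b\<^sup>2"
    using assms by (simp add: power2_eq_square field_simps)
  finally show ?thesis by (simp add: power2_eq_square algebra_simps)
qed

lemma norm_L2_add_le_weighted:
  assumes a: "set_integrable lborel {0..1} (\<lambda>x. (a x)\<^sup>2)" and b: "set_integrable lborel {0..1} (\<lambda>x. (b x)\<^sup>2)"
    and ab: "set_integrable lborel {0..1} (\<lambda>x. (a x + b x)\<^sup>2)" and k: "0 < k"
  shows "(norm_L2 (\<lambda>x. a x + b x))\<^sup>2 \<le> (1 + k) * (norm_L2 a)\<^sup>2 + (1 + 1 / k) * (norm_L2 b)\<^sup>2"
proof -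
  have int: "set_integrable lborel {0..1} (\<lambda>x. (1 + k) * (a x)\<^sup>2)" "set_integrable lborel {0..1} (\<lambda>x. (1 + 1 / k) * (b x)\<^sup>2)"
    using a b by auto
  have "(norm_L2 (\<lambda>x. a x + b x))\<^sup>2 \<le> (LBINT x:{0..1}. (1 + k) * (a x)\<^sup>2 + (1 + 1 / k) * (b x)\<^sup>2)"
    unfolding norm_L2_power2
    using ab set_integral_add(1)[OF int] power2_add_le_weighted[OF k] by (intro set_integral_mono) auto
  also have "\<dots> = (1 + k) * (norm_L2 a)\<^sup>2 + (1 + 1 / k) * (norm_L2 b)\<^sup>2"
    unfolding norm_L2_power2 set_integral_add(2)[OF int] by simp
  finally show ?thesis .
qed

lemma hoelder_ball_shift: "g \<in> hoelder_ball \<beta> R \<Longrightarrow> (\<lambda>x. g x + t) \<in> hoelder_ball \<beta> R"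
  by (simp add: hoelder_ball_def)

section \<open>Bounds uniform over an L2 neighbourhood\<close>

context
  fixes \<beta> R :: real
  assumes \<beta>: "0 < \<beta>" and R: "0 < R"
begin

lemma hoelder_ball_bounded: "g \<in> hoelder_ball \<beta> R \<Longrightarrow> x \<in> {0..1} \<Longrightarrow> \<bar>g x\<bar> \<le> \<bar>g 0\<bar> + R"
  using hoelder_ball_osc[OF _ \<beta> R, of g x 0] by auto

lemma set_integrable_hoelder_diff:
  assumes "f \<in> hoelder_ball \<beta> R" "g \<in> hoelder_ball \<beta> R"
  shows "set_integrable lborel {0..1} (\<lambda>x. (f x - g x)\<^sup>2)"
  by (intro borel_integrable_atLeastAtMost' continuous_intros hoelder_ball_continuous[OF _ \<beta> R] assms)

text \<open>If |f - g| exceeded 2 on all of [0,1], the squared distance would be at least 4. So the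
  curves are within 2 of each other somewhere, and one oscillation R of each curve spreads this. The
  bound involves f only, which makes the tail constant uniform in g.\<close>

lemma hoelder_ball_uniform_bound:
  assumes f: "f \<in> hoelder_ball \<beta> R" and g: "g \<in> hoelder_ball \<beta> R"
    and d: "norm_L2 (\<lambda>x. f x - g x) \<le> 1" and x: "x \<in> {0..1}"
  shows "\<bar>g x\<bar> \<le> \<bar>f 0\<bar> + 2 * R + 2"
proof -
  have "\<exists>y\<in>{0..1}. \<bar>f y - g y\<bar> \<le> 2"
  proof (rule ccontr)
    assume far: "\<not> ?thesis"
    have *: "4 \<le> (f y - g y)\<^sup>2" if "y \<in> {0..1}" for y
    proof -
      have "2 \<le> \<bar>f y - g y\<bar>" using far that by (meson less_imp_le not_le)
      then have "2\<^sup>2 \<le> \<bar>f y - g y\<bar>\<^sup>2" by (rule power_mono) simp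
      then show ?thesis by simp
    qed
    have "(4::real) = (LBINT y:{0..1::real}. 4)" by (simp add: set_lebesgue_integral_def)
    also have "\<dots> \<le> (LBINT y:{0..1}. (f y - g y)\<^sup>2)"
      by (intro set_integral_mono set_integrable_hoelder_diff f g *) (auto simp: set_integrable_def)
    also have "\<dots> = (norm_L2 (\<lambda>x. f x - g x))\<^sup>2" by (simp add: norm_L2_power2)
    also have "\<dots> \<le> 1\<^sup>2" using d by (intro power_mono) (auto simp: norm_L2_def set_lebesgue_integral_def)
    finally show False by simp
  qed
  then obtain y where "y \<in> {0..1}" "\<bar>f y - g y\<bar> \<le> 2" by blast
  moreover from this have "\<bar>f y\<bar> \<le> \<bar>f 0\<bar> + R" "\<bar>g x - g y\<bar> \<le> R"
    using hoelder_ball_bounded[OF f] hoelder_ball_osc[OF g \<beta> R x] by auto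
  ultimately show ?thesis by linarith
qed

context
  fixes C :: real and \<Phi>' :: "real \<Rightarrow> real"
  assumes C: "0 < C" and growth: "\<And>u. \<bar>\<Phi>' u\<bar> \<le> C * exp (C * \<bar>u\<bar>)"
    and meas [measurable]: "\<Phi>' \<in> borel_measurable borel"
begin

lemma growth_le: "\<bar>u\<bar> \<le> B \<Longrightarrow> \<bar>\<Phi>' u\<bar> \<le> C * exp (C * B)"
  using growth[of u] C by (smt (verit) exp_le_cancel_iff mult_left_mono)

lemma set_integrable_compose:
  assumes g: "g \<in> hoelder_ball \<beta> R" and h: "h \<in> hoelder_ball \<beta> R"
  shows "set_integrable lborel {0..1} (\<lambda>x. (\<Phi>' (g x))\<^sup>2)"
    and "set_integrable lborel {0..1} (\<lambda>x. (\<Phi>' (g x) - \<Phi>' (h x))\<^sup>2)"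
proof -
  note [measurable] = hoelder_ball_clamp_measurable[OF g \<beta> R, THEN measurable_compose, OF meas]
    hoelder_ball_clamp_measurable[OF h \<beta> R, THEN measurable_compose, OF meas]
  define A where "A = C * exp (C * (\<bar>g 0\<bar> + R)) + C * exp (C * (\<bar>h 0\<bar> + R))"
  have b: "\<bar>\<Phi>' (g x)\<bar> \<le> C * exp (C * (\<bar>g 0\<bar> + R))" "\<bar>\<Phi>' (h x)\<bar> \<le> C * exp (C * (\<bar>h 0\<bar> + R))"
    if "x \<in> {0..1}" for x
    using that g h by (auto intro!: growth_le hoelder_ball_bounded)
  have A: "0 \<le> C * exp (C * (\<bar>g 0\<bar> + R))" "0 \<le> C * exp (C * (\<bar>h 0\<bar> + R))" using C by auto
  have sq: "\<bar>u\<^sup>2\<bar> \<le> A\<^sup>2" if "\<bar>u\<bar> \<le> A" for u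
    using that by (metis abs_ge_zero power2_abs power_abs power_mono)
  show "set_integrable lborel {0..1} (\<lambda>x. (\<Phi>' (g x))\<^sup>2)"
  proof (rule set_integrable_bounded_clamp)
    show "(\<lambda>x. (\<Phi>' (g (clamp01 x)))\<^sup>2) \<in> borel_measurable borel" by measurable
    show "\<bar>(\<Phi>' (g x))\<^sup>2\<bar> \<le> A\<^sup>2" if "x \<in> {0..1}" for x
      using b[OF that] A by (intro sq) (simp add: A_def)
  qed
  show "set_integrable lborel {0..1} (\<lambda>x. (\<Phi>' (g x) - \<Phi>' (h x))\<^sup>2)"
  proof (rule set_integrable_bounded_clamp)
    show "(\<lambda>x. (\<Phi>' (g (clamp01 x)) - \<Phi>' (h (clamp01 x)))\<^sup>2) \<in> borel_measurable borel" by measurable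
    show "\<bar>(\<Phi>' (g x) - \<Phi>' (h x))\<^sup>2\<bar> \<le> A\<^sup>2" if "x \<in> {0..1}" for x
      using b[OF that] A by (intro sq) (simp add: A_def abs_le_iff)
  qed
qed

lemma local_second_moment_le:
  assumes f: "f \<in> hoelder_ball \<beta> R" and cont: "L2_continuous_on_at (hoelder_ball \<beta> R) (\<lambda>g. \<Phi>' \<circ> g) f"
    and k: "0 < k"
  obtains \<eta> where "0 < \<eta>" and "\<And>g t. g \<in> hoelder_ball \<beta> R \<Longrightarrow> norm_L2 (\<lambda>x. f x - g x) \<le> \<eta> \<Longrightarrow> 0 \<le> t \<Longrightarrow> t \<le> \<eta> \<Longrightarrow>
    (\<integral>\<^sup>+x. ennreal ((\<Phi>' (g x + t))\<^sup>2) * indicator {0..1} x \<partial>lborel) \<le> ennreal ((1 + k) * (norm_L2 (\<Phi>' \<circ> f))\<^sup>2 + k)"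
proof -
  \<comment> \<open>Chosen so that the weighted error term (1 + 1/k) \<epsilon>^2 equals k.\<close>
  define \<epsilon> where "\<epsilon> = sqrt (k / (1 + 1 / k))"
  have \<epsilon>: "0 < \<epsilon>" "(1 + 1 / k) * \<epsilon>\<^sup>2 = k"
  proof -
    have "0 < 1 + 1 / k" using k by (simp add: add_pos_pos)
    then show "0 < \<epsilon>" "(1 + 1 / k) * \<epsilon>\<^sup>2 = k" using k by (simp_all add: \<epsilon>_def)
  qed
  from cont \<epsilon>(1) obtain d where d: "0 < d" "\<And>g. g \<in> hoelder_ball \<beta> R \<Longrightarrow> norm_L2 (\<lambda>x. g x - f x) < d \<Longrightarrow>
      norm_L2 (\<lambda>x. \<Phi>' (g x) - \<Phi>' (f x)) < \<epsilon>"
    unfolding L2_continuous_on_at_def by (auto simp: comp_def)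
  show ?thesis
  \<comment> \<open>With weight 1, distance and shift together cost at most 2 (d/3)^2 + 2 (d/3)^2 =
    4 d^2/9 < d^2.\<close>
  proof (rule that[of "d / 3"])
    show "0 < d / 3" using d by simp
    fix g t assume g: "g \<in> hoelder_ball \<beta> R" and gf: "norm_L2 (\<lambda>x. f x - g x) \<le> d / 3" and t: "0 \<le> t" "t \<le> d / 3"
    let ?h = "\<lambda>x. g x + t"
    have h: "?h \<in> hoelder_ball \<beta> R" using hoelder_ball_shift[OF g] .
    have "(norm_L2 (\<lambda>x. (g x - f x) + t))\<^sup>2 \<le> (1 + 1) * (norm_L2 (\<lambda>x. g x - f x))\<^sup>2 + (1 + 1 / 1) * (norm_L2 (\<lambda>x. t))\<^sup>2"
      using set_integrable_hoelder_diff[OF h f] set_integrable_hoelder_diff[OF g f]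
      by (intro norm_L2_add_le_weighted) (auto simp: algebra_simps set_integrable_def)
    also have "norm_L2 (\<lambda>x. g x - f x) = norm_L2 (\<lambda>x. f x - g x)"
      by (simp add: norm_L2_def power2_commute)
    also have "(norm_L2 (\<lambda>x. t))\<^sup>2 = t\<^sup>2"
      by (simp add: norm_L2_power2 set_lebesgue_integral_def)
    also have "(1 + 1) * (norm_L2 (\<lambda>x. f x - g x))\<^sup>2 + (1 + 1 / 1) * t\<^sup>2 \<le> (1 + 1) * (d / 3)\<^sup>2 + (1 + 1 / 1) * (d / 3)\<^sup>2"
      using gf t by (intro add_mono mult_left_mono power_mono) (auto simp: norm_L2_def set_lebesgue_integral_def)
    also have "\<dots> < d\<^sup>2" using d(1) by (simp add: power2_eq_square field_simps)
    finally have "norm_L2 (\<lambda>x. ?h x - f x) < d"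
      using d(1) by (simp add: power2_less_imp_less algebra_simps)
    then have "norm_L2 (\<lambda>x. \<Phi>' (?h x) - \<Phi>' (f x)) < \<epsilon>" by (rule d(2)[OF h])
    then have "(1 + 1 / k) * (norm_L2 (\<lambda>x. \<Phi>' (?h x) - \<Phi>' (f x)))\<^sup>2 \<le> (1 + 1 / k) * \<epsilon>\<^sup>2"
      using k
      by (intro mult_left_mono power_mono) (auto simp: norm_L2_def set_lebesgue_integral_def)
    then have small: "(1 + 1 / k) * (norm_L2 (\<lambda>x. \<Phi>' (?h x) - \<Phi>' (f x)))\<^sup>2 \<le> k"
      by (simp only: \<epsilon>(2))
    have "(norm_L2 (\<lambda>x. \<Phi>' (f x) + (\<Phi>' (?h x) - \<Phi>' (f x))))\<^sup>2 \<le>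
      (1 + k) * (norm_L2 (\<lambda>x. \<Phi>' (f x)))\<^sup>2 + (1 + 1 / k) * (norm_L2 (\<lambda>x. \<Phi>' (?h x) - \<Phi>' (f x)))\<^sup>2"
      using set_integrable_compose[OF h f] set_integrable_compose(1)[OF f f] k
      by (intro norm_L2_add_le_weighted) auto
    then have "(norm_L2 (\<lambda>x. \<Phi>' (?h x)))\<^sup>2 \<le> (1 + k) * (norm_L2 (\<Phi>' \<circ> f))\<^sup>2 + k"
      using small by (simp add: comp_def)
    then show "(\<integral>\<^sup>+x. ennreal ((\<Phi>' (g x + t))\<^sup>2) * indicator {0..1} x \<partial>lborel) \<le> ennreal ((1 + k) * (norm_L2 (\<Phi>' \<circ> f))\<^sup>2 + k)"
      unfolding nn_integral_power2_eq_norm_L2[OF set_integrable_compose(1)[OF h f]] by (rule ennreal_leI)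
  qed
qed

lemma second_moment_growth:
  fixes g :: "real \<Rightarrow> real"
  assumes "\<And>x. x \<in> {0..1} \<Longrightarrow> \<bar>g x\<bar> \<le> B" "0 \<le> t"
  shows "(\<integral>\<^sup>+x. ennreal ((\<Phi>' (g x + t))\<^sup>2) * indicator {0..1} x \<partial>lborel) \<le> ennreal (C\<^sup>2 * exp (2 * C * B) * exp (2 * C * t))"
proof -
  have "(\<Phi>' (g x + t))\<^sup>2 \<le> C\<^sup>2 * exp (2 * C * B) * exp (2 * C * t)" if "x \<in> {0..1}" for x
  proof -
    have "\<bar>\<Phi>' (g x + t)\<bar> \<le> C * exp (C * (B + t))"
      using assms(1)[OF that] assms(2) by (intro growth_le) auto
    then have "\<bar>\<Phi>' (g x + t)\<bar>\<^sup>2 \<le> (C * exp (C * (B + t)))\<^sup>2" by (intro power_mono) auto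
    also have "(C * exp (C * (B + t)))\<^sup>2 = C\<^sup>2 * (exp (C * (B + t)) * exp (C * (B + t)))"
      by (simp add: power2_eq_square)
    also have "exp (C * (B + t)) * exp (C * (B + t)) = exp (2 * C * B) * exp (2 * C * t)"
      by (simp only: mult_exp_exp) (simp add: algebra_simps)
    finally show ?thesis by (simp add: mult.assoc)
  qed
  then have *: "ennreal ((\<Phi>' (g x + t))\<^sup>2) * indicator {0..1} x \<le>
    ennreal (C\<^sup>2 * exp (2 * C * B) * exp (2 * C * t)) * indicator {0..1::real} x" for x
    by (simp add: indicator_def ennreal_leI)
  have "(\<integral>\<^sup>+x. ennreal ((\<Phi>' (g x + t))\<^sup>2) * indicator {0..1} x \<partial>lborel) \<le>
    (\<integral>\<^sup>+x. ennreal (C\<^sup>2 * exp (2 * C * B) * exp (2 * C * t)) * indicator {0..1::real} x \<partial>lborel)"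
    by (rule nn_integral_mono) (rule *)
  also have "\<dots> = ennreal (C\<^sup>2 * exp (2 * C * B) * exp (2 * C * t))"
    by (subst nn_integral_cmult_indicator) auto
  finally show ?thesis .
qed

text \<open>Split at \<open>\<tau>\<close>. Up to it the second moment is at most A and the rate is
  the pure power with factor b; beyond it the rate is at least c t against a second moment of growth
  exp(2 C t), whence the condition n c > 2 C.\<close>

lemma risk_integral_le:
  fixes n :: nat
  assumes n: "1 \<le> n" and \<tau>: "0 < \<tau>" "\<tau> \<le> 2 * R * (1 / 2) powr \<beta>"
    and near: "\<And>t. 0 \<le> t \<Longrightarrow> t \<le> \<tau> \<Longrightarrow> I t \<le> ennreal A" and far: "\<And>t. 0 \<le> t \<Longrightarrow> I t \<le> ennreal (D * exp (2 * C * t))"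
    and AD: "0 \<le> A" "0 \<le> D"
  defines "c \<equiv> min (1 / 2) ((\<tau> / (2 * R)) powr (1 / \<beta>)) * (\<beta> / (\<beta> + 1))"
    and "b \<equiv> \<beta> / (\<beta> + 1) * (2 * R) powr (- 1 / \<beta>)" and "q \<equiv> \<beta> / (\<beta> + 1)"
  assumes nc: "2 * C < real n * c"
  shows "(\<integral>\<^sup>+t. ennreal (exp (- real n * rate \<beta> R t)) * I t * indicator {0..} t \<partial>lborel) \<le>
    ennreal (A * (Gamma (1 + q) * (real n * b) powr (- q)) + D * (exp (- (real n * c - 2 * C) * \<tau>) / (real n * c - 2 * C)))"
proof -
  have b: "0 < b" using \<beta> R by (simp add: b_def)
  have q: "0 < q" "1 / ((\<beta> + 1) / \<beta>) = q" "- 1 / ((\<beta> + 1) / \<beta>) = - q" using \<beta> by (simp_all add: q_def)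
  \<comment> \<open>The near part is majorised on the whole half-line rather than up to
    \<open>\<tau>\<close>: the excess is of lower order, and the integral becomes an exact Gamma
    value.\<close>
  let ?near = "\<lambda>t. ennreal A * (ennreal (exp (- ((real n * b) * t powr ((\<beta> + 1) / \<beta>)))) * indicator {0..} t)"
  let ?far = "\<lambda>t. ennreal D * (ennreal (exp (- (real n * c - 2 * C) * t)) * indicator {\<tau>..} t)"
  have "(\<integral>\<^sup>+t. ennreal (exp (- real n * rate \<beta> R t)) * I t * indicator {0..} t \<partial>lborel) \<le>
    (\<integral>\<^sup>+t. ?near t + ?far t \<partial>lborel)"
  proof (rule nn_integral_mono)
    fix t :: real
    consider "t < 0" | "0 \<le> t" "t \<le> \<tau>" | "0 \<le> t" "\<tau> \<le> t" by linarith
    then show "ennreal (exp (- real n * rate \<beta> R t)) * I t * indicator {0..} t \<le> ?near t + ?far t"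
    proof cases
      case 2
      have "rate \<beta> R t = b * t powr ((\<beta> + 1) / \<beta>)"
        unfolding b_def using 2 \<tau> by (intro rate_small \<beta> R) auto
      then have "ennreal (exp (- real n * rate \<beta> R t)) * I t * indicator {0..} t =
        I t * (ennreal (exp (- ((real n * b) * t powr ((\<beta> + 1) / \<beta>)))) * indicator {0..} t)"
        by (simp add: mult_ac)
      also have "\<dots> \<le> ?near t" using near[OF 2] by (intro mult_right_mono) auto
      finally show ?thesis by (rule order_trans) simp
    next
      case 3
      have "t * c \<le> rate \<beta> R t" unfolding c_def using 3 \<tau> by (intro rate_large \<beta> R) auto
      then have "real n * (t * c) \<le> real n * rate \<beta> R t" by (intro mult_left_mono) auto
      then have "exp (- real n * rate \<beta> R t) \<le> exp (- (real n * (t * c)))" by simp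
      then have "ennreal (exp (- real n * rate \<beta> R t)) * I t \<le>
        ennreal (exp (- (real n * (t * c)))) * ennreal (D * exp (2 * C * t))"
        using far[OF 3(1)] by (intro mult_mono ennreal_leI) auto
      also have "\<dots> = ennreal D * ennreal (exp (- (real n * c - 2 * C) * t))"
        using AD by (simp add: mult_exp_exp algebra_simps flip: ennreal_mult')
      also have "\<dots> = ?far t" using 3 by simp
      finally have "ennreal (exp (- real n * rate \<beta> R t)) * I t * indicator {0..} t \<le> ?far t" using 3 by simp
      then show ?thesis by (rule order_trans) simp
    qed simp
  qed
  also have "\<dots> = ennreal A * (\<integral>\<^sup>+t. ennreal (exp (- ((real n * b) * t powr ((\<beta> + 1) / \<beta>)))) * indicator {0..} t \<partial>lborel) +
    ennreal D * (\<integral>\<^sup>+t. ennreal (exp (- (real n * c - 2 * C) * t)) * indicator {\<tau>..} t \<partial>lborel)"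
    by (subst nn_integral_add) (simp_all add: nn_integral_cmult)
  also have "(\<integral>\<^sup>+t. ennreal (exp (- ((real n * b) * t powr ((\<beta> + 1) / \<beta>)))) * indicator {0..} t \<partial>lborel) =
    ennreal (Gamma (1 + q) * (real n * b) powr (- q))"
    using nn_integral_exp_neg_powr[of "real n * b" "(\<beta> + 1) / \<beta>"] b n \<beta> unfolding q(2,3) by simp
  also have "(\<integral>\<^sup>+t. ennreal (exp (- (real n * c - 2 * C) * t)) * indicator {\<tau>..} t \<partial>lborel) =
    ennreal (exp (- (real n * c - 2 * C) * \<tau>) / (real n * c - 2 * C))"
    using nc by (intro nn_integral_exp_tail) auto
  also have "ennreal A * ennreal (Gamma (1 + q) * (real n * b) powr (- q)) +
      ennreal D * ennreal (exp (- (real n * c - 2 * C) * \<tau>) / (real n * c - 2 * C)) =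
    ennreal (A * (Gamma (1 + q) * (real n * b) powr (- q)) + D * (exp (- (real n * c - 2 * C) * \<tau>) / (real n * c - 2 * C)))"
  proof -
    have "ennreal A * ennreal X + ennreal D * ennreal Y = ennreal (A * X + D * Y)" if "0 \<le> X" "0 \<le> Y" for X Y
      using that AD by (simp add: ennreal_mult)
    then show ?thesis
      using nc q(1) Gamma_real_pos[of "1 + q"] by (simp add: less_imp_le del: ennreal_plus)
  qed
  finally show ?thesis .
qed

end

end

section \<open>Passage to the limit\<close>

lemma tail_negligible:
  fixes q C c \<tau> D :: real
  assumes "0 < c" "0 < \<tau>"
  shows "(\<lambda>n. real n powr q * (D * (exp (- (real n * c - 2 * C) * \<tau>) / (real n * c - 2 * C)))) \<longlonglongrightarrow> 0"
  using assms by real_asymp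

theorem corollary2p10:
  fixes \<beta> R C :: real and \<Phi> \<Phi>' f :: "real \<Rightarrow> real"
    and M :: "nat \<Rightarrow> (real \<Rightarrow> real) \<Rightarrow> 'w measure"
    and Z :: "nat \<Rightarrow> (real \<Rightarrow> real) \<Rightarrow> nat \<Rightarrow> 'w \<Rightarrow> real \<times> real"
  assumes "0 < \<beta>" "\<beta> \<le> 1" and "R > 0"
    and ppp: "\<And>n g. n \<ge> 1 \<Longrightarrow> g \<in> hoelder_ball \<beta> R \<Longrightarrow>
      poisson_point_process (M n g) (boundary_intensity n g) (Z n g)"
    and "has_weak_derivative \<Phi> \<Phi>'"
    and "C > 0" and "\<And>u. \<bar>\<Phi>' u\<bar> \<le> C * exp (C * \<bar>u\<bar>)"
    and "f \<in> hoelder_ball \<beta> R"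
    and "norm_L2 (\<Phi>' \<circ> f) \<noteq> 0"
    and "L2_continuous_on_at (hoelder_ball \<beta> R) (\<lambda>g. \<Phi>' \<circ> g) f"
  shows "\<exists>L. ((\<lambda>\<delta>. limsup (\<lambda>n.
            SUP g\<in>{g \<in> hoelder_ball \<beta> R. norm_L2 (\<lambda>x. f x - g x) \<le> \<delta>}.
              ennreal (real n powr ((2 * \<beta> + 1) / (\<beta> + 1))) *
              mean_squared_error (M n g) (Z n g) (estimator \<beta> R \<Phi> \<Phi>' n) (functional \<Phi> g)))
          \<longlongrightarrow> L) (at_right 0) \<and>
        L \<le> ennreal (Gamma (\<beta> / (\<beta> + 1)) * (2 * R * \<beta> / (\<beta> + 1)) powr (1 / (\<beta> + 1)) *
               (norm_L2 (\<Phi>' \<circ> f))\<^sup>2)"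
proof -
  define q where "q = \<beta> / (\<beta> + 1)"
  define c0 where "c0 = Gamma q * (2 * R * q) powr (1 / (\<beta> + 1))"
  define N where "N = (norm_L2 (\<Phi>' \<circ> f))\<^sup>2"
  have q: "0 < q" "(2 * \<beta> + 1) / (\<beta> + 1) = 1 + q" using assms(1) by (simp_all add: q_def field_simps)
  have eq: "2 * R * q = 2 * R * \<beta> / (\<beta> + 1)" by (simp add: q_def)
  have N: "0 \<le> N" by (simp add: N_def)
  have meas: "\<Phi>' \<in> borel_measurable borel" by (rule weak_derivative_measurable[OF assms(5)])
  define S where "S \<delta> = {g \<in> hoelder_ball \<beta> R. norm_L2 (\<lambda>x. f x - g x) \<le> \<delta>}" for \<delta>
  define risk where "risk n g = ennreal (real n powr ((2 * \<beta> + 1) / (\<beta> + 1))) *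
    mean_squared_error (M n g) (Z n g) (estimator \<beta> R \<Phi> \<Phi>' n) (functional \<Phi> g)" for n g
  define U where "U \<delta> = limsup (\<lambda>n. SUP g\<in>S \<delta>. risk n g)" for \<delta>
  have mono: "U \<delta> \<le> U \<delta>'" if "\<delta> \<le> \<delta>'" for \<delta> \<delta>'
    unfolding U_def using that
    by (intro Limsup_mono always_eventually allI SUP_subset_mono) (auto simp: S_def)
  \<comment> \<open>One radius per k suffices, since the limit will be an infimum over radii; k
    tends to 0 only at the end.\<close>
  have bound: "(INF \<delta>\<in>{0<..}. U \<delta>) \<le> ennreal (((1 + k) * N + k) * c0)" if k: "0 < k" for k
  proof -
    define A where "A = (1 + k) * N + k"
    have A: "0 \<le> A" using k N by (simp add: A_def)
    obtain \<eta> where \<eta>: "0 < \<eta>" "\<And>g t. g \<in> hoelder_ball \<beta> R \<Longrightarrow> norm_L2 (\<lambda>x. f x - g x) \<le> \<eta> \<Longrightarrow> 0 \<le> t \<Longrightarrow> t \<le> \<eta> \<Longrightarrow>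
        (\<integral>\<^sup>+x. ennreal ((\<Phi>' (g x + t))\<^sup>2) * indicator {0..1} x \<partial>lborel) \<le> ennreal A"
      unfolding A_def N_def
      by (rule local_second_moment_le[OF assms(1,3,6,7) meas assms(8,10) k]) blast
    \<comment> \<open>\<open>\<eta>\<close> limits the shifts covered by L2 continuity; the other
      bound keeps the cap in \<open>rate\<close> inactive.\<close>
    define \<tau> where "\<tau> = min \<eta> (2 * R * (1 / 2) powr \<beta>)"
    define D where "D = C\<^sup>2 * exp (2 * C * (\<bar>f 0\<bar> + 2 * R + 2))"
    define c where "c = min (1 / 2) ((\<tau> / (2 * R)) powr (1 / \<beta>)) * (\<beta> / (\<beta> + 1))"
    define b where "b = \<beta> / (\<beta> + 1) * (2 * R) powr (- 1 / \<beta>)"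
    define Y where "Y n = D * (exp (- (real n * c - 2 * C) * \<tau>) / (real n * c - 2 * C))" for n
    have \<tau>: "0 < \<tau>" "\<tau> \<le> \<eta>" "\<tau> \<le> 2 * R * (1 / 2) powr \<beta>" using \<eta>(1) assms(3) by (simp_all add: \<tau>_def)
    have c: "0 < c" using \<tau> assms(1,3) by (simp add: c_def)
    \<comment> \<open>The radius 1 serves the uniform bound on g behind \<open>D\<close>, the radius
      \<open>\<eta>\<close> the near-field bound \<open>A\<close>.\<close>
    have risk_le: "risk n g \<le> ennreal (A * c0 + real n powr q * Y n)"
      if n1: "1 \<le> n" "2 * C < real n * c" and g: "g \<in> S (min 1 \<eta>)" for n g
    proof -
      have g': "g \<in> hoelder_ball \<beta> R" "norm_L2 (\<lambda>x. f x - g x) \<le> 1" "norm_L2 (\<lambda>x. f x - g x) \<le> \<eta>"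
        using g by (simp_all add: S_def)
      define X where "X = Gamma (1 + q) * (real n * b) powr (- q)"
      interpret boundary_model "M n g" n g "Z n g" \<beta> R
        by (intro boundary_model.intro ppp boundary_model_axioms.intro assms n1 g')
      have "mean_squared_error (M n g) (Z n g) (estimator \<beta> R \<Phi> \<Phi>' n) (functional \<Phi> g) \<le>
        ennreal (1 / real n) * (\<integral>\<^sup>+t. ennreal (exp (- real n * rate \<beta> R t)) *
          (\<integral>\<^sup>+x. ennreal ((\<Phi>' (g x + t))\<^sup>2) * indicator {0..1} x \<partial>lborel) * indicator {0..} t \<partial>lborel)"
        by (rule mean_squared_error_le[OF assms(5,6,7)])
      also have "(\<integral>\<^sup>+t. ennreal (exp (- real n * rate \<beta> R t)) *
          (\<integral>\<^sup>+x. ennreal ((\<Phi>' (g x + t))\<^sup>2) * indicator {0..1} x \<partial>lborel) * indicator {0..} t \<partial>lborel) \<le>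
          ennreal (A * X + Y n)"
        unfolding X_def Y_def q_def b_def c_def
      proof (rule risk_integral_le[OF assms(1,3,6,7) meas n1(1) \<tau>(1,3)])
        show "(\<integral>\<^sup>+x. ennreal ((\<Phi>' (g x + t))\<^sup>2) * indicator {0..1} x \<partial>lborel) \<le> ennreal A"
          if "0 \<le> t" "t \<le> \<tau>" for t
          using that \<tau> by (intro \<eta>(2) g') auto
        show "(\<integral>\<^sup>+x. ennreal ((\<Phi>' (g x + t))\<^sup>2) * indicator {0..1} x \<partial>lborel) \<le> ennreal (D * exp (2 * C * t))"
          if "0 \<le> t" for t
          unfolding D_def using that hoelder_ball_uniform_bound[OF assms(1,3,8) g'(1,2)]
          by (intro second_moment_growth[OF assms(1,3,6,7) meas]) auto
      qed (use A n1(2) in \<open>simp_all add: D_def c_def\<close>)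
      finally have mse: "mean_squared_error (M n g) (Z n g) (estimator \<beta> R \<Phi> \<Phi>' n) (functional \<Phi> g) \<le>
        ennreal (1 / real n) * ennreal (A * X + Y n)"
        by (simp add: mult_left_mono)
      have "risk n g \<le> ennreal (real n powr (1 + q)) * (ennreal (1 / real n) * ennreal (A * X + Y n))"
        unfolding risk_def q(2) by (rule mult_left_mono[OF mse]) simp
      also have "\<dots> = ennreal (real n powr (1 + q) * (1 / real n) * (A * X + Y n))"
        by (simp add: mult.assoc flip: ennreal_mult')
      \<comment> \<open>One power of n is spent on the prefactor 1/n; the remaining n^q is cancelled
        exactly by \<open>leading_constant\<close>.\<close>
      also have "real n powr (1 + q) * (1 / real n) * (A * X + Y n) = A * (real n powr q * X) + real n powr q * Y n"
        using n1(1) by (simp add: powr_add field_simps)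
      also have "real n powr q * X = c0"
        using leading_constant[OF assms(1,3) _ q_def, of "real n"] n1(1) by (simp add: X_def b_def q_def c0_def)
      finally show ?thesis .
    qed
    have "(INF \<delta>\<in>{0<..}. U \<delta>) \<le> U (min 1 \<eta>)" using \<eta>(1) by (intro INF_lower) auto
    also have "\<dots> \<le> limsup (\<lambda>n. ennreal (A * c0 + real n powr q * Y n))"
      unfolding U_def
    proof (rule Limsup_mono)
      have "filterlim (\<lambda>n. c * real n) at_top sequentially"
        using c by (intro filterlim_tendsto_pos_mult_at_top[OF tendsto_const] filterlim_real_sequentially)
      then have "\<forall>\<^sub>F n in sequentially. 2 * C < c * real n" by (simp add: filterlim_at_top_dense)
      then show "\<forall>\<^sub>F n in sequentially. (SUP g\<in>S (min 1 \<eta>). risk n g) \<le> ennreal (A * c0 + real n powr q * Y n)"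
        using eventually_ge_at_top[of 1]
        by eventually_elim (intro SUP_least risk_le; simp add: mult.commute)
    qed
    also have "\<dots> = ennreal (A * c0)"
    proof (rule lim_imp_Limsup)
      have "(\<lambda>n. A * c0 + real n powr q * Y n) \<longlonglongrightarrow> A * c0 + 0"
        unfolding Y_def by (intro tendsto_add tendsto_const tail_negligible c \<tau>)
      then show "(\<lambda>n. ennreal (A * c0 + real n powr q * Y n)) \<longlonglongrightarrow> ennreal (A * c0)"
        by (intro tendsto_ennrealI) simp
    qed simp
    finally show ?thesis by (simp add: A_def)
  qed
  have "(U \<longlongrightarrow> (INF \<delta>\<in>{0<..}. U \<delta>)) (at_right 0)"
    by (rule tendsto_at_right_INF) (rule mono)
  moreover have "(INF \<delta>\<in>{0<..}. U \<delta>) \<le> ennreal (c0 * N)"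
  proof (rule tendsto_lowerbound)
    have "((\<lambda>k. ((1 + k) * N + k) * c0) \<longlongrightarrow> ((1 + 0) * N + 0) * c0) (at_right 0)"
      by (intro tendsto_intros)
    then show "((\<lambda>k. ennreal (((1 + k) * N + k) * c0)) \<longlongrightarrow> ennreal (c0 * N)) (at_right 0)"
      by (intro tendsto_ennrealI) (simp add: mult.commute)
    show "\<forall>\<^sub>F k in at_right 0. (INF \<delta>\<in>{0<..}. U \<delta>) \<le> ennreal (((1 + k) * N + k) * c0)"
      using eventually_at_right_less[of 0] by eventually_elim (rule bound)
  qed simp
  ultimately show ?thesis
    unfolding U_def[abs_def] S_def risk_def c0_def N_def eq unfolding q_def by (intro exI conjI)
qed

end
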